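(* Let $\Omega\subset\mathbb{R}^n$ be a bounded domain. Assume that $f\in C(\Omega\times\mathbb{R})$ satisfies, for every $x\in\Omega$, $f(x,0)=0$ and $f(x,t)\ge0$ for all $t>0$, and that there exist $a_1,a_2\ge0$ and $p\in[0,\frac{1+s}{1-s})$ with $f(x,t)\le a_1+a_2t^p$ for all $t>0$, $x\in\Omega$ (no monotonicity of $f$ in $t$ is assumed). Then the problem $$(-\Delta)^su=-f(x,u)\ \text{in }\Omega,\qquad u=0\ \text{in }\mathbb{R}^n\setminus\overline\Omega,\qquad E_\Omega u=0\ \text{on }\partial\Omega$$ does not admit a large solution.
   Context: Here $n\ge2$, $s\in(0,1)$, $(-\Delta)^su(x)=\mathcal{A}(n,s)\,\mathrm{p.v.}\int_{\mathbb{R}^n}\frac{u(x)-u(y)}{|x-y|^{n+2s}}dy$ with $\mathcal{A}(n,s)=\frac{\Gamma(n/2+s)}{\pi^{n/2}\Gamma(2-s)}s(1-s)$; $\delta_\Omega(x)=\mathrm{dist}(x,\partial\Omega)$; $L^\infty_c(\Omega)$ is the set of bounded functions with compact support in $\Omega$; $\mathcal{H}$ is the $(n-1)$-dimensional measure on the boundary. Green's kernel: $\mathbb{G}_\Omega(x,y)=\Gamma_s(x-y)-H_\Omega(x,y)$ for $x\in\Omega$, $y\in\mathbb{R}^n$, where $\Gamma_s(x)=a(n,s)|x|^{2s-n}$, $a(n,s)=\frac{\Gamma(n/2-s)}{\pi^{n/2}\Gamma(2+s)}s(1+s)$, and $H_\Omega(x,\cdot)$ is the $s$-harmonic function solving pointwise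 $(-\Delta)^sH_\Omega(x,\cdot)=0$ in $\Omega$, $H_\Omega(x,y)=\Gamma_s(x-y)$ for $y\in\mathbb{R}^n\setminus\overline\Omega$. $D_sv(\theta)=\lim_{y\in\Omega,\,y\to\theta}v(y)/\delta_\Omega^s(y)$ for $\theta\in\partial\Omega$; $D_s\mathbb{G}_\Omega(x,\theta)$ is taken in the second variable; $E_\Omega v(\theta)=\lim_{x\in\Omega,\,x\to\theta}\frac{v(x)}{\int_{\partial\Omega}D_s\mathbb{G}_\Omega(x,\sigma)d\mathcal{H}(\sigma)}$. Green's potential: $\mathcal{G}_\Omega(\psi)(x)=\int_\Omega\mathbb{G}_\Omega(x,y)\psi(y)dy$ for $x\in\Omega$, and $0$ for $x\in\mathbb{R}^n\setminus\Omega$. Solutions are weak dual: $u\in L^1_{loc}(\Omega)$ (with $u=0$ outside $\overline\Omega$) is a solution of the problem if $\int_\Omega u\psi\,dx=-\int_\Omega f(x,u(x))\,\mathcal{G}_\Omega(\psi)(x)\,dx$ for every $\psi\in L^\infty_c(\Omega)$. A large (boundary blow-up) solution is a solution $u$ with $u(x)\to+\infty$ as $x\in\Omega$, $x\to\partial\Omega$. *)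

theory Defs
  imports "HOL-Analysis.Analysis"
begin

text \<open>
  Throughout, \<open>'a :: euclidean_space\<close> is $\mathbb{R}^n$ with \<open>n = DIM('a)\<close>, and
  \<open>infdist x (frontier \<Omega>)\<close> is the distance $\delta_\Omega(x)$ to the boundary.
\<close>

section \<open>Surface measure\<close>

text \<open>
  The library has no Hausdorff measure.  Covering sets are required to be bounded because the
  library's \<open>diameter\<close> of an unbounded set carries no information.  The normalisation by the volume
  of the unit ball makes the $d$-dimensional measure agree with surface area on $d$-dimensional
  surfaces.
\<close>

definition hausdorff_pre :: "nat \<Rightarrow> real \<Rightarrow> 'a::euclidean_space set \<Rightarrow> ennreal" where
  "hausdorff_pre d \<epsilon> A =
     (INF C \<in> {C :: nat \<Rightarrow> 'a set. A \<subseteq> (\<Union>i. C i) \<and> (\<forall>i. bounded (C i) \<and> diameter (C i) \<le> \<epsilon>)}.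
        \<Sum>i. ennreal (unit_ball_vol (real d) * (diameter (C i) / 2) ^ d))"

definition hausdorff_outer :: "nat \<Rightarrow> 'a::euclidean_space set \<Rightarrow> ennreal" where
  "hausdorff_outer d A = (SUP \<epsilon> \<in> {0<..}. hausdorff_pre d \<epsilon> A)"

text \<open>
  The outer measure is a metric outer measure, hence countably additive on the Borel sets, so
  \<open>measure_of\<close> does not fall back to the null measure here.
\<close>

definition hausdorff_measure :: "nat \<Rightarrow> 'a::euclidean_space measure" where
  "hausdorff_measure d = measure_of UNIV (sets borel) (hausdorff_outer d)"

section \<open>The fractional Laplacian\<close>

definition frac_const :: "'a::euclidean_space itself \<Rightarrow> real \<Rightarrow> real" where
  "frac_const _ s =
     Gamma (real DIM('a) / 2 + s) / (pi powr (real DIM('a) / 2) * Gamma (2 - s)) * s * (1 - s)"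

text \<open>
  \<open>has_frac_laplacian s u x l\<close>: the principal value defining $(-\Delta)^s u(x)$ exists and yields \<open>l\<close>.
\<close>

definition has_frac_laplacian ::
    "real \<Rightarrow> ('a::euclidean_space \<Rightarrow> real) \<Rightarrow> 'a \<Rightarrow> real \<Rightarrow> bool" where
  "has_frac_laplacian s u x l \<longleftrightarrow>
     (\<forall>\<epsilon>>0. set_integrable lebesgue (- ball x \<epsilon>)
        (\<lambda>y. (u x - u y) / norm (x - y) powr (real DIM('a) + 2 * s))) \<and>
     ((\<lambda>\<epsilon>. frac_const TYPE('a) s *
          (LINT y : - ball x \<epsilon> | lebesgue. (u x - u y) / norm (x - y) powr (real DIM('a) + 2 * s)))
        \<longlongrightarrow> l) (at_right 0)"

section \<open>Green's kernel and Green's potential\<close>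

definition fundamental_solution :: "real \<Rightarrow> 'a::euclidean_space \<Rightarrow> real" where
  "fundamental_solution s x =
     Gamma (real DIM('a) / 2 - s) / (pi powr (real DIM('a) / 2) * Gamma (2 + s)) * s * (1 + s)
       * norm x powr (2 * s - real DIM('a))"

text \<open>
  The regular part \<open>H\<close>.  Without a condition across the boundary, the exterior problem has many
  pointwise solutions: on the unit ball, $(1-|y|^2)^{s-1}$ extended by zero is $s$-harmonic and
  vanishes outside the closed ball.  Continuity on the whole space is the usual condition that
  singles out the intended solution.
\<close>

definition green_regular_part ::
    "real \<Rightarrow> 'a::euclidean_space set \<Rightarrow> ('a \<Rightarrow> 'a \<Rightarrow> real) \<Rightarrow> bool" where
  "green_regular_part s \<Omega> H \<longleftrightarrow>
     (\<forall>x\<in>\<Omega>. continuous_on UNIV (H x) \<and>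
            (\<forall>y\<in>\<Omega>. has_frac_laplacian s (H x) y 0) \<and>
            (\<forall>y\<in>- closure \<Omega>. H x y = fundamental_solution s (x - y)))"

definition green_kernel ::
    "real \<Rightarrow> 'a::euclidean_space set \<Rightarrow> ('a \<Rightarrow> 'a \<Rightarrow> real) \<Rightarrow> bool" where
  "green_kernel s \<Omega> G \<longleftrightarrow>
     (\<exists>H. green_regular_part s \<Omega> H \<and>
          (\<forall>x\<in>\<Omega>. \<forall>y. G x y = fundamental_solution s (x - y) - H x y))"

definition green_potential ::
    "'a::euclidean_space set \<Rightarrow> ('a \<Rightarrow> 'a \<Rightarrow> real) \<Rightarrow> ('a \<Rightarrow> real) \<Rightarrow> 'a \<Rightarrow> real" where
  "green_potential \<Omega> G \<psi> x = (if x \<in> \<Omega> then LINT y : \<Omega> | lebesgue. G x y * \<psi> y else 0)"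

section \<open>Boundary operators\<close>

definition has_Ds ::
    "real \<Rightarrow> 'a::euclidean_space set \<Rightarrow> ('a \<Rightarrow> real) \<Rightarrow> 'a \<Rightarrow> real \<Rightarrow> bool" where
  "has_Ds s \<Omega> v \<theta> l \<longleftrightarrow>
     ((\<lambda>y. v y / infdist y (frontier \<Omega>) powr s) \<longlongrightarrow> l) (at \<theta> within \<Omega>)"

text \<open>
  \<open>has_E s \<Omega> G v \<theta> l\<close>: the limit $E_\Omega v(\theta)$ is meaningful and equals \<open>l\<close>.  In particular the
  boundary trace \<open>D\<close> of the kernel, the integral of \<open>D\<close> over the boundary and the quotient must
  exist; this excludes the default values of non-integrable functions and of division by zero.
\<close>

definition has_E ::
    "real \<Rightarrow> 'a::euclidean_space set \<Rightarrow> ('a \<Rightarrow> 'a \<Rightarrow> real) \<Rightarrow> ('a \<Rightarrow> real) \<Rightarrow> 'a \<Rightarrow> real \<Rightarrow> bool" where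
  "has_E s \<Omega> G v \<theta> l \<longleftrightarrow>
     (\<exists>D. (\<forall>x\<in>\<Omega>. \<forall>\<sigma>\<in>frontier \<Omega>. has_Ds s \<Omega> (G x) \<sigma> (D x \<sigma>)) \<and>
          (\<forall>x\<in>\<Omega>. set_integrable (hausdorff_measure (DIM('a) - 1)) (frontier \<Omega>) (D x)) \<and>
          (\<forall>\<^sub>F x in at \<theta> within \<Omega>.
             (LINT \<sigma> : frontier \<Omega> | hausdorff_measure (DIM('a) - 1). D x \<sigma>) \<noteq> 0) \<and>
          ((\<lambda>x. v x / (LINT \<sigma> : frontier \<Omega> | hausdorff_measure (DIM('a) - 1). D x \<sigma>))
             \<longlongrightarrow> l) (at \<theta> within \<Omega>))"

section \<open>Weak dual and large solutions\<close>

definition Linf_c :: "'a::euclidean_space set \<Rightarrow> ('a \<Rightarrow> real) set" where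
  "Linf_c \<Omega> = {\<psi>. \<psi> \<in> borel_measurable lebesgue \<and> bounded (range \<psi>) \<and>
                 (\<exists>K. compact K \<and> K \<subseteq> \<Omega> \<and> (\<forall>x. x \<notin> K \<longrightarrow> \<psi> x = 0))}"

definition L1_loc :: "'a::euclidean_space set \<Rightarrow> ('a \<Rightarrow> real) set" where
  "L1_loc \<Omega> = {u. \<forall>K. compact K \<and> K \<subseteq> \<Omega> \<longrightarrow> set_integrable lebesgue K u}"

text \<open>
  Weak dual solutions of $(-\Delta)^s u = -f(x,u)$ in $\Omega$, $u = 0$ outside $\overline\Omega$,
  $E_\Omega u = 0$ on $\partial\Omega$.  The integral on the left exists for every \<open>u \<in> L1_loc \<Omega>\<close>;
  existence of the one on the right is part of the requirement.
\<close>

definition weak_dual_solution ::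
    "real \<Rightarrow> 'a::euclidean_space set \<Rightarrow> ('a \<Rightarrow> 'a \<Rightarrow> real) \<Rightarrow> ('a \<Rightarrow> real \<Rightarrow> real) \<Rightarrow> ('a \<Rightarrow> real) \<Rightarrow> bool"
  where
  "weak_dual_solution s \<Omega> G f u \<longleftrightarrow>
     u \<in> L1_loc \<Omega> \<and>
     (\<forall>x\<in>- closure \<Omega>. u x = 0) \<and>
     (\<forall>\<theta>\<in>frontier \<Omega>. has_E s \<Omega> G u \<theta> 0) \<and>
     (\<forall>\<psi>\<in>Linf_c \<Omega>.
        set_integrable lebesgue \<Omega> (\<lambda>x. f x (u x) * green_potential \<Omega> G \<psi> x) \<and>
        (LINT x : \<Omega> | lebesgue. u x * \<psi> x) =
          - (LINT x : \<Omega> | lebesgue. f x (u x) * green_potential \<Omega> G \<psi> x))"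

definition blows_up_at_boundary :: "'a::euclidean_space set \<Rightarrow> ('a \<Rightarrow> real) \<Rightarrow> bool" where
  "blows_up_at_boundary \<Omega> u \<longleftrightarrow>
     (\<forall>M. \<exists>\<eta>>0. \<forall>x\<in>\<Omega>. infdist x (frontier \<Omega>) < \<eta> \<longrightarrow> M < u x)"

definition large_solution ::
    "real \<Rightarrow> 'a::euclidean_space set \<Rightarrow> ('a \<Rightarrow> 'a \<Rightarrow> real) \<Rightarrow> ('a \<Rightarrow> real \<Rightarrow> real) \<Rightarrow> ('a \<Rightarrow> real) \<Rightarrow> bool"
  where
  "large_solution s \<Omega> G f u \<longleftrightarrow> weak_dual_solution s \<Omega> G f u \<and> blows_up_at_boundary \<Omega> u"

end

theory Submission
  imports Defs
begin

text \<open>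
  A Green kernel satisfies $0 \le G(x,y) \le \Gamma_s(x-y)$ by the maximum principle, since
  $\Gamma_s$ is $s$-harmonic away from its pole.  Let $u$ be a large solution and $\psi$ the
  indicator of a small ball $B$ close to the boundary.  There $u > 0$, so the boundary region
  contributes with a favourable sign to $\int u\psi = -\int f(x,u)\,\mathcal{G}(\psi)$, and what
  remains is the integral over a fixed compact set $K$.  On $K$ the function $f(x,u)$ is integrable
  and $\mathcal{G}(\psi) \le C|B|$.  Hence the mean of $u$ over $B$ is bounded independently of $B$,
  which contradicts the blow-up.
\<close>

section \<open>Inversion in a sphere and radial integrals\<close>

text \<open>Three things behind the outline need work. All that is known about the interior
  behaviour of \<open>G\<close> is the pointwise harmonicity of its regular part, so the kernel
  bounds have to come from comparison, and the comparison function with the pole must first be shown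
  harmonic straight from the principal value. An exact symmetry under inversion, combined with a
  measure that inversion preserves, does this without evaluating any integral. Comparison also needs
  boundary values on the whole complement of \<open>\<Omega>\<close>; on the frontier they come from
  the trace that is part of \<open>has_E\<close>. Finally, \<open>u\<close> is merely locally
  integrable and \<open>f\<close> carries no growth bound for negative arguments, so integrability
  of \<open>f x (u x)\<close> on \<open>K\<close> is extracted from the notion of solution: the
  product with every Green potential is integrable, and suitable potentials are bounded below. The
  bound on \<open>K\<close> and the mass of the test function are both proportional to the volume of
  the ball, which therefore cancels at the end.\<close>

lemma nn_integral_scale:
  fixes F :: "'a::euclidean_space \<Rightarrow> ennreal"
  assumes [measurable]: "F \<in> borel_measurable borel" and c: "0 < c"
  shows "(\<integral>\<^sup>+y. F y \<partial>lborel) = ennreal (c ^ DIM('a)) * (\<integral>\<^sup>+y. F (c *\<^sub>R y) \<partial>lborel)"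
  by (subst lborel_affine[of c 0])
     (use c in \<open>simp_all add: nn_integral_density nn_integral_distr nn_integral_cmult\<close>)

lemma nn_integral_real_reflect:
  fixes F :: "real \<Rightarrow> ennreal"
  assumes [measurable]: "F \<in> borel_measurable borel"
  shows "(\<integral>\<^sup>+t. F (a - t) \<partial>lborel) = (\<integral>\<^sup>+t. F t \<partial>lborel)"
  by (subst (2) nn_integral_real_affine[where c="-1" and t=a]) simp_all

abbreviation unit_shell :: "'a::euclidean_space set" where
  "unit_shell \<equiv> {y. 1 \<le> norm y \<and> norm y < exp 1}"

lemma nn_integral_shell_dilates:
  fixes y :: "'a::euclidean_space"
  assumes "y \<noteq> 0"
  shows "(\<integral>\<^sup>+t. indicator unit_shell (exp t *\<^sub>R y) \<partial>lborel) = 1"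
proof -
  have n: "0 < norm y" using assms by simp
  have *: "(exp t *\<^sub>R y \<in> unit_shell) = (t \<in> {- ln (norm y)..<1 - ln (norm y)})" for t
  proof -
    have "norm (exp t *\<^sub>R y) = exp (t + ln (norm y))" using n by (simp add: exp_add)
    moreover have "(1 \<le> exp (t + ln (norm y))) = (0 \<le> t + ln (norm y))" by simp
    moreover have "(exp (t + ln (norm y)) < exp 1) = (t + ln (norm y) < 1)" by simp
    ultimately show ?thesis by auto
  qed
  have "(\<integral>\<^sup>+t. indicator unit_shell (exp t *\<^sub>R y) \<partial>lborel)
      = (\<integral>\<^sup>+t. indicator {- ln (norm y)..<1 - ln (norm y)} t \<partial>lborel)"
    using * by (intro nn_integral_cong) (auto simp: indicator_def)
  then show ?thesis by simp
qed

text \<open>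
  A substitute for polar coordinates that needs no surface measure: every ray meets \<open>unit_shell\<close>
  in logarithmic length one, so inserting that factor and exchanging the integrals moves the
  dilation onto the integrand.
\<close>

lemma nn_integral_polar:
  fixes h :: "'a::euclidean_space \<Rightarrow> ennreal"
  assumes [measurable]: "h \<in> borel_measurable borel"
  shows "(\<integral>\<^sup>+y. h y * ennreal (norm y powr - real DIM('a)) \<partial>lborel) =
    (\<integral>\<^sup>+y. (\<integral>\<^sup>+t. h (exp t *\<^sub>R y) \<partial>lborel) *
        (ennreal (norm y powr - real DIM('a)) * indicator unit_shell y) \<partial>lborel)"
proof -
  define k where "k y = ennreal (norm y powr - real DIM('a))" for y :: 'a
  have [measurable]: "k \<in> borel_measurable borel" unfolding k_def by measurable
  \<comment> \<open>The Jacobian of the dilation cancels against the weight: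
    \<open>norm y powr - n\<close> times Lebesgue measure is dilation invariant.\<close>
  have k_scale: "ennreal (exp t ^ DIM('a)) * k (exp t *\<^sub>R y) = k y" for t y
    by (cases "y = 0")
       (simp_all add: k_def powr_mult ennreal_mult[symmetric] powr_realpow[symmetric]
          mult.assoc[symmetric] powr_add[symmetric])
  have "(\<integral>\<^sup>+y. h y * k y \<partial>lborel)
      = (\<integral>\<^sup>+y. \<integral>\<^sup>+t. h y * k y * indicator unit_shell (exp t *\<^sub>R y) \<partial>lborel \<partial>lborel)"
  proof (intro nn_integral_cong)
    fix y :: 'a
    \<comment> \<open>No dilate of the origin meets the shell, but both sides vanish there because
      \<open>0 powr c = 0\<close>.\<close>
    show "h y * k y = (\<integral>\<^sup>+t. h y * k y * indicator unit_shell (exp t *\<^sub>R y) \<partial>lborel)"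
      by (cases "y = 0") (simp_all add: nn_integral_cmult nn_integral_shell_dilates, simp add: k_def)
  qed
  also have "\<dots> = (\<integral>\<^sup>+t. \<integral>\<^sup>+y. h y * k y * indicator unit_shell (exp t *\<^sub>R y) \<partial>lborel \<partial>lborel)"
    by (intro lborel_pair.Fubini') measurable
  also have "\<dots> = (\<integral>\<^sup>+t. \<integral>\<^sup>+y. h (exp (0 - t) *\<^sub>R y) * k y * indicator unit_shell y \<partial>lborel \<partial>lborel)"
  proof (rule nn_integral_cong)
    fix t :: real
    have "(\<integral>\<^sup>+y. h y * k y * indicator unit_shell (exp t *\<^sub>R y) \<partial>lborel)
       = (\<integral>\<^sup>+y. ennreal (exp (-t) ^ DIM('a)) *
           (h (exp (-t) *\<^sub>R y) * k (exp (-t) *\<^sub>R y) * indicator unit_shell (exp t *\<^sub>R exp (-t) *\<^sub>R y)) \<partial>lborel)"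
      by (subst nn_integral_scale[where c="exp (-t)"]) (simp_all add: nn_integral_cmult)
    also have "\<dots> = (\<integral>\<^sup>+y. h (exp (0 - t) *\<^sub>R y) * k y * indicator unit_shell y \<partial>lborel)"
    proof (intro nn_integral_cong)
      fix y :: 'a
      have "exp t *\<^sub>R exp (-t) *\<^sub>R y = y" by (simp add: exp_minus)
      then show "ennreal (exp (-t) ^ DIM('a)) *
           (h (exp (-t) *\<^sub>R y) * k (exp (-t) *\<^sub>R y) * indicator unit_shell (exp t *\<^sub>R exp (-t) *\<^sub>R y))
         = h (exp (0 - t) *\<^sub>R y) * k y * indicator unit_shell y"
        by (simp only: k_scale[of "-t" y, symmetric]) (simp add: ac_simps)
    qed
    finally show "(\<integral>\<^sup>+y. h y * k y * indicator unit_shell (exp t *\<^sub>R y) \<partial>lborel)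
       = (\<integral>\<^sup>+y. h (exp (0 - t) *\<^sub>R y) * k y * indicator unit_shell y \<partial>lborel)" .
  qed
  also have "\<dots> = (\<integral>\<^sup>+t. \<integral>\<^sup>+y. h (exp t *\<^sub>R y) * k y * indicator unit_shell y \<partial>lborel \<partial>lborel)"
    by (rule nn_integral_real_reflect) measurable
  also have "\<dots> = (\<integral>\<^sup>+y. \<integral>\<^sup>+t. h (exp t *\<^sub>R y) * k y * indicator unit_shell y \<partial>lborel \<partial>lborel)"
    by (intro lborel_pair.Fubini'[symmetric]) measurable
  also have "\<dots> = (\<integral>\<^sup>+y. (\<integral>\<^sup>+t. h (exp t *\<^sub>R y) \<partial>lborel) * (k y * indicator unit_shell y) \<partial>lborel)"
    by (simp add: nn_integral_multc mult.assoc)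
  finally show ?thesis unfolding k_def .
qed

section \<open>Inversion in a sphere and its invariant measure\<close>

definition sphere_inv :: "real \<Rightarrow> 'a::euclidean_space \<Rightarrow> 'a" where
  "sphere_inv R y = (R\<^sup>2 / (norm y)\<^sup>2) *\<^sub>R y"

lemma sphere_inv_measurable [measurable]: "sphere_inv R \<in> borel_measurable borel"
  unfolding sphere_inv_def by measurable

lemma norm_sphere_inv: "norm (sphere_inv R y) = R\<^sup>2 / norm y"
  by (cases "y = 0") (simp_all add: sphere_inv_def power2_eq_square)

text \<open>This is the conformal distortion formula of inversion for a point \<open>z\<close> on
  the sphere itself, which inversion fixes. The distance to \<open>z\<close> thus changes by a
  factor that depends on \<open>norm y\<close> only.\<close>

lemma dist_sphere_inv:
  assumes "y \<noteq> 0"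
  shows "norm (z - sphere_inv (norm z) y) = norm z / norm y * norm (z - y)"
proof (rule power2_eq_imp_eq)
  define N where "N = norm y"
  define Z where "Z = norm z"
  have N: "0 < N" using assms by (simp add: N_def)
  have a: "(norm (z - c *\<^sub>R y))\<^sup>2 = Z\<^sup>2 - 2 * c * (z \<bullet> y) + c\<^sup>2 * N\<^sup>2" for c
    unfolding N_def Z_def power2_norm_eq_inner
    by (simp add: inner_diff inner_commute power2_eq_square algebra_simps del: dot_square_norm)
  show "(norm (z - sphere_inv (norm z) y))\<^sup>2 = (norm z / norm y * norm (z - y))\<^sup>2"
  proof -
    have *: "(norm (z - y))\<^sup>2 = Z\<^sup>2 - 2 * (z \<bullet> y) + N\<^sup>2" using a[of 1] by simp
    show ?thesis
      unfolding sphere_inv_def a * power_mult_distrib power_divide N_def[symmetric] Z_def[symmetric]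
      using N by (simp add: field_simps power2_eq_square)
  qed
qed (simp_all)

text \<open>On the logarithmic radius, inversion acts as a reflection of each ray, and reflections
  preserve length. Hence the dilation-invariant measure is invariant under inversion too.\<close>

lemma nn_integral_sphere_inv:
  fixes h :: "'a::euclidean_space \<Rightarrow> ennreal"
  assumes [measurable]: "h \<in> borel_measurable borel" and R: "0 < R"
  shows "(\<integral>\<^sup>+y. h (sphere_inv R y) * ennreal (norm y powr - real DIM('a)) \<partial>lborel) =
         (\<integral>\<^sup>+y. h y * ennreal (norm y powr - real DIM('a)) \<partial>lborel)"
proof -
  have "(\<integral>\<^sup>+t. h (sphere_inv R (exp t *\<^sub>R y)) \<partial>lborel) = (\<integral>\<^sup>+t. h (exp t *\<^sub>R y) \<partial>lborel)"
    if y: "y \<noteq> 0" for y :: 'a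
  proof -
    have "sphere_inv R (exp t *\<^sub>R y) = exp ((2 * ln R - 2 * ln (norm y)) - t) *\<^sub>R y" for t
    proof -
      have "exp (2 * ln R - 2 * ln (norm y) - t) = R\<^sup>2 / (norm y)\<^sup>2 / exp t"
        using R y by (simp add: exp_diff exp_double)
      then show ?thesis using y R by (simp add: sphere_inv_def power2_eq_square)
    qed
    then have "(\<integral>\<^sup>+t. h (sphere_inv R (exp t *\<^sub>R y)) \<partial>lborel)
        = (\<integral>\<^sup>+t. h (exp ((2 * ln R - 2 * ln (norm y)) - t) *\<^sub>R y) \<partial>lborel)" by simp
    also have "\<dots> = (\<integral>\<^sup>+t. h (exp t *\<^sub>R y) \<partial>lborel)"
      by (rule nn_integral_real_reflect) measurable
    finally show ?thesis .
  qed
  note inner = this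
  show ?thesis
  proof (subst (1 2) nn_integral_polar, measurable, intro nn_integral_cong)
    fix y :: 'a
    show "(\<integral>\<^sup>+t. h (sphere_inv R (exp t *\<^sub>R y)) \<partial>lborel) *
        (ennreal (norm y powr - real DIM('a)) * indicator unit_shell y) =
      (\<integral>\<^sup>+t. h (exp t *\<^sub>R y) \<partial>lborel) *
        (ennreal (norm y powr - real DIM('a)) * indicator unit_shell y)"
      by (cases "y = 0") (simp_all add: inner)
  qed
qed

text \<open>Signed integrands are reached by proving that the weighted measure equals its own image
  under inversion; both claims are then the change of variables for that image.\<close>

lemma
  fixes g :: "'a::euclidean_space \<Rightarrow> real"
  assumes g[measurable]: "g \<in> borel_measurable borel" and R: "0 < R"
  defines "k \<equiv> \<lambda>y::'a. norm y powr - real DIM('a)"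
  shows integrable_sphere_inv:
      "integrable lborel (\<lambda>y. k y * g y) \<Longrightarrow> integrable lborel (\<lambda>y. k y * g (sphere_inv R y))"
    and integral_sphere_inv:
      "(\<integral>y. k y * g (sphere_inv R y) \<partial>lborel) = (\<integral>y. k y * g y \<partial>lborel)"
proof -
  define \<mu> where "\<mu> = density lborel (\<lambda>y. ennreal (k y))"
  have k[measurable]: "k \<in> borel_measurable borel" unfolding k_def by measurable
  have [simp]: "0 \<le> k y" for y by (simp add: k_def)
  have "distr \<mu> borel (sphere_inv R) = \<mu>"
  proof (rule measure_eqI)
    fix A assume "A \<in> sets (distr \<mu> borel (sphere_inv R :: 'a \<Rightarrow> 'a))"
    then have A[measurable]: "A \<in> sets borel" by simp
    have "emeasure (distr \<mu> borel (sphere_inv R)) A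
        = (\<integral>\<^sup>+y. indicator A y \<partial>distr \<mu> borel (sphere_inv R))"
      by simp
    also have "\<dots> = (\<integral>\<^sup>+y. indicator A (sphere_inv R y) \<partial>\<mu>)"
      by (rule nn_integral_distr) (simp_all add: \<mu>_def)
    also have "\<dots> = (\<integral>\<^sup>+y. indicator A (sphere_inv R y) * ennreal (k y) \<partial>lborel)"
      unfolding \<mu>_def by (subst nn_integral_density)
        (auto intro!: nn_integral_cong split: split_indicator)
    also have "\<dots> = (\<integral>\<^sup>+y. indicator A y * ennreal (k y) \<partial>lborel)"
      using nn_integral_sphere_inv[of "indicator A", OF _ R] by (simp add: k_def)
    also have "\<dots> = emeasure \<mu> A"
      by (simp add: \<mu>_def emeasure_density mult.commute)
    finally show "emeasure (distr \<mu> borel (sphere_inv R)) A = emeasure \<mu> A" .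
  qed (simp add: \<mu>_def)
  note D = this
  have m: "sphere_inv R \<in> measurable \<mu> borel" by (simp add: \<mu>_def)
  have e: "integrable \<mu> F = integrable lborel (\<lambda>y. k y * F y)"
    "integral\<^sup>L \<mu> F = (\<integral>y. k y * F y \<partial>lborel)" if [measurable]: "F \<in> borel_measurable borel" for F :: "'a \<Rightarrow> real"
    unfolding \<mu>_def by (simp_all add: integrable_density integral_density)
  show "integrable lborel (\<lambda>y. k y * g y) \<Longrightarrow> integrable lborel (\<lambda>y. k y * g (sphere_inv R y))"
    using integrable_distr_eq[OF m, of g] by (simp add: D e)
  show "(\<integral>y. k y * g (sphere_inv R y) \<partial>lborel) = (\<integral>y. k y * g y \<partial>lborel)"
    using integral_distr[OF m, of g] by (simp add: D e)
qed

section \<open>Integrability of powers of the norm\<close>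

text \<open>A radial integrand has the same logarithmic ray integral in every direction. What is
  left is the weight over the shell, and there it is at most 1.\<close>

lemma nn_integral_radial_finite:
  fixes \<phi> :: "real \<Rightarrow> ennreal"
  assumes [measurable]: "\<phi> \<in> borel_measurable borel" and fin: "(\<integral>\<^sup>+t. \<phi> (exp t) \<partial>lborel) < \<infinity>"
  shows "(\<integral>\<^sup>+y. \<phi> (norm (y::'a::euclidean_space)) * ennreal (norm y powr - real DIM('a)) \<partial>lborel) < \<infinity>"
proof -
  let ?I = "\<integral>\<^sup>+t. \<phi> (exp t) \<partial>lborel"
  have ray: "(\<integral>\<^sup>+t. \<phi> (norm (exp t *\<^sub>R y)) \<partial>lborel) = ?I" if "y \<noteq> 0" for y :: 'a
  proof -
    have "?I = (\<integral>\<^sup>+t. \<phi> (exp (ln (norm y) + t)) \<partial>lborel)"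
      by (subst nn_integral_real_affine[where c=1 and t="ln (norm y)"]) simp_all
    also have "\<dots> = (\<integral>\<^sup>+t. \<phi> (norm (exp t *\<^sub>R y)) \<partial>lborel)"
      using that by (simp add: exp_add mult.commute)
    finally show ?thesis by simp
  qed
  have "(\<integral>\<^sup>+y. \<phi> (norm (y::'a)) * ennreal (norm y powr - real DIM('a)) \<partial>lborel)
      = (\<integral>\<^sup>+(y::'a). ?I * (ennreal (norm y powr - real DIM('a)) * indicator unit_shell y) \<partial>lborel)"
  proof (subst nn_integral_polar, measurable, intro nn_integral_cong)
    fix y :: 'a
    show "(\<integral>\<^sup>+t. \<phi> (norm (exp t *\<^sub>R y)) \<partial>lborel) *
        (ennreal (norm y powr - real DIM('a)) * indicator unit_shell y) =
      ?I * (ennreal (norm y powr - real DIM('a)) * indicator unit_shell y)"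
      by (cases "y = 0") (simp_all add: ray del: norm_scaleR)
  qed
  also have "\<dots> \<le> (\<integral>\<^sup>+(y::'a). ?I * indicator (ball 0 (exp 1)) y \<partial>lborel)"
  proof (intro nn_integral_mono mult_left_mono)
    fix y :: 'a
    have "norm y powr - real DIM('a) \<le> 1" if "1 \<le> norm y"
      using powr_mono[of "- real DIM('a)" 0 "norm y"] that by (auto split: if_splits)
    then show "ennreal (norm y powr - real DIM('a)) * indicator unit_shell y
        \<le> indicator (ball 0 (exp 1)) y"
      by (auto split: split_indicator)
  qed simp
  also have "\<dots> = ?I * emeasure lborel (ball (0::'a) (exp 1))"
    by (simp add: nn_integral_cmult_indicator)
  also have "\<dots> < \<infinity>"
    using fin emeasure_bounded_finite[of "ball (0::'a) (exp 1)"] by (simp add: ennreal_mult_less_top)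
  finally show ?thesis .
qed

lemma nn_integral_exp_decay:
  assumes "0 < b"
  shows "(\<integral>\<^sup>+t. ennreal (exp (- b * t)) * indicator {a..} t \<partial>lborel) < \<infinity>"
proof -
  have "(\<integral>\<^sup>+t. ennreal (exp (- b * t)) * indicator {a..} t \<partial>lborel) = ennreal (0 - (- exp (- b * a) / b))"
  proof (rule nn_integral_FTC_atLeast)
    show "((\<lambda>t. - exp (- b * t) / b) has_real_derivative exp (- b * x)) (at x)" for x
      using assms by (auto intro!: derivative_eq_intros)
    have "filterlim (\<lambda>t. - b * t) at_bot at_top"
      using assms by (intro filterlim_tendsto_neg_mult_at_bot[OF tendsto_const _ filterlim_ident]) auto
    then have "((\<lambda>t. exp (- b * t)) \<longlongrightarrow> 0) at_top"
      by (rule filterlim_compose[OF exp_at_bot])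
    from tendsto_divide[OF tendsto_minus[OF this] tendsto_const[of b]]
    show "((\<lambda>t. - exp (- b * t) / b) \<longlongrightarrow> 0) at_top" using assms by simp
  qed simp_all
  then show ?thesis by simp
qed

text \<open>Relative to the invariant weight only \<open>r powr - b\<close> remains, which in the
  logarithmic variable is a decaying exponential on the half-line from
  \<open>ln \<epsilon>\<close>.\<close>

lemma integrable_norm_powr_tail:
  assumes b: "0 < b" and \<epsilon>: "0 < \<epsilon>"
  shows "integrable lborel
    (\<lambda>y::'a::euclidean_space. indicator {y. \<epsilon> \<le> norm y} y * norm y powr - (real DIM('a) + b))"
proof (rule integrableI_nonneg)
  define \<phi> where "\<phi> r = ennreal (r powr - b) * indicator {\<epsilon>..} r" for r :: real
  have [measurable]: "\<phi> \<in> borel_measurable borel" unfolding \<phi>_def by measurable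
  have "\<phi> (exp t) = ennreal (exp (- b * t)) * indicator {ln \<epsilon>..} t" for t
    using \<epsilon> by (auto simp: \<phi>_def powr_def ln_ge_iff split: split_indicator) (metis exp_le_cancel_iff exp_ln)+
  then have "(\<integral>\<^sup>+t. \<phi> (exp t) \<partial>lborel) < \<infinity>"
    using nn_integral_exp_decay[OF b, of "ln \<epsilon>"] by simp
  from nn_integral_radial_finite[OF _ this, where 'a='a]
  have "(\<integral>\<^sup>+y. \<phi> (norm (y::'a)) * ennreal (norm y powr - real DIM('a)) \<partial>lborel) < \<infinity>" by simp
  also have "(\<lambda>y::'a. \<phi> (norm y) * ennreal (norm y powr - real DIM('a)))
    = (\<lambda>y. ennreal (indicator {y. \<epsilon> \<le> norm y} y * norm y powr - (real DIM('a) + b)))"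
    by (auto simp: \<phi>_def fun_eq_iff ennreal_mult[symmetric] powr_add[symmetric] add.commute
        split: split_indicator)
  finally show "(\<integral>\<^sup>+y. ennreal (indicator {y::'a. \<epsilon> \<le> norm y} y * norm y powr - (real DIM('a) + b)) \<partial>lborel) < \<infinity>" .
qed simp_all

text \<open>Reflecting the logarithmic variable exchanges the origin with infinity, so the same
  exponential tail serves again.\<close>

lemma integrable_norm_powr_near_zero:
  assumes b: "0 < b"
  shows "integrable lborel
    (\<lambda>y::'a::euclidean_space. indicator (ball 0 r) y * norm y powr (b - real DIM('a)))"
proof (cases "0 < r")
  case r: True
  show ?thesis
  proof (rule integrableI_nonneg)
    \<comment> \<open>The closed cut-off \<open>{..r}\<close> turns exactly into the half-line
      \<open>{- ln r..}\<close>; the open ball then costs only an inequality.\<close>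
    define \<phi> where "\<phi> u = ennreal (u powr b) * indicator {..r} u" for u :: real
    have [measurable]: "\<phi> \<in> borel_measurable borel" unfolding \<phi>_def by measurable
    have "\<phi> (exp (0 - t)) = ennreal (exp (- b * t)) * indicator {- ln r..} t" for t
      using r ln_ge_iff[OF r, of "- t"] by (auto simp: \<phi>_def powr_def indicator_def)
    moreover have "(\<integral>\<^sup>+t. \<phi> (exp (0 - t)) \<partial>lborel) = (\<integral>\<^sup>+t. \<phi> (exp t) \<partial>lborel)"
      by (rule nn_integral_real_reflect) measurable
    ultimately have "(\<integral>\<^sup>+t. \<phi> (exp t) \<partial>lborel) < \<infinity>"
      using nn_integral_exp_decay[OF b, of "- ln r"] by simp
    from nn_integral_radial_finite[OF _ this, where 'a='a]
    have fin: "(\<integral>\<^sup>+y. \<phi> (norm (y::'a)) * ennreal (norm y powr - real DIM('a)) \<partial>lborel) < \<infinity>" by simp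
    have "ennreal (indicator (ball 0 r) y * norm y powr (b - real DIM('a)))
        \<le> \<phi> (norm y) * ennreal (norm y powr - real DIM('a))" for y :: 'a
      by (auto simp: \<phi>_def ennreal_mult[symmetric] powr_add[symmetric] split: split_indicator)
    then show "(\<integral>\<^sup>+y. ennreal (indicator (ball 0 r) y * norm y powr (b - real DIM('a))) \<partial>(lborel::'a measure)) < \<infinity>"
      by (rule le_less_trans[OF nn_integral_mono fin])
  qed (auto intro!: borel_measurable_times borel_measurable_indicator)
qed (simp add: ball_empty)

section \<open>The fundamental solution is $s$-harmonic away from its pole\<close>

lemma lborel_distr_reflect: "distr lborel borel (\<lambda>y. x - y) = (lborel :: 'a::euclidean_space measure)"
  by (subst (2) lborel_affine[of "-1" x]) (simp_all add: density_1)

lemma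
  fixes F :: "'a::euclidean_space \<Rightarrow> real"
  assumes [measurable]: "F \<in> borel_measurable borel"
  shows integrable_reflect: "integrable lborel (\<lambda>y. F (x - y)) = integrable lborel F"
    and integral_reflect: "(\<integral>y. F (x - y) \<partial>lborel) = (\<integral>y. F y \<partial>lborel)"
proof -
  have m: "(\<lambda>y. x - y) \<in> measurable lborel borel" by simp
  show "integrable lborel (\<lambda>y. F (x - y)) = integrable lborel F"
    using integrable_distr_eq[OF m, of F] by (simp add: lborel_distr_reflect)
  show "(\<integral>y. F (x - y) \<partial>lborel) = (\<integral>y. F y \<partial>lborel)"
    using integral_distr[OF m, of F] by (simp add: lborel_distr_reflect)
qed

text \<open>Principal values are stated over \<open>lebesgue\<close>, while the changes of variables
  live on \<open>lborel\<close>; for Borel integrands the completion changes nothing.\<close>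

lemma
  fixes F :: "'a::euclidean_space \<Rightarrow> real"
  assumes [measurable]: "F \<in> borel_measurable borel" "A \<in> sets borel"
  shows set_integrable_lebesgue_borel:
      "set_integrable lebesgue A F = integrable lborel (\<lambda>y. indicator A y * F y)"
    and set_integral_lebesgue_borel:
      "(LINT y:A|lebesgue. F y) = (\<integral>y. indicator A y * F y \<partial>lborel)"
  unfolding set_integrable_def set_lebesgue_integral_def
  by (simp_all add: integrable_completion integral_completion)

lemma integrable_frac_tail:
  fixes z :: "'a::euclidean_space"
  assumes "0 < s" "0 < \<epsilon>"
  shows "integrable lborel
    (\<lambda>y. indicator (- ball z \<epsilon>) y * norm (z - y) powr - (real DIM('a) + 2 * s))"
proof -
  have "integrable lborel (\<lambda>y. indicator {y. \<epsilon> \<le> norm y} (z - y) * norm (z - y) powr - (real DIM('a) + 2 * s))"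
    using integrable_reflect[of "\<lambda>y. indicator {y. \<epsilon> \<le> norm y} y * norm y powr - (real DIM('a) + 2 * s)" z]
      integrable_norm_powr_tail[where 'a='a, of "2 * s" \<epsilon>] assms by simp
  then show ?thesis
    by (rule Bochner_Integration.integrable_cong[THEN iffD1, rotated -1])
       (auto simp: dist_norm indicator_def)
qed

section \<open>Elementary estimates and harmonicity of the power\<close>

text \<open>For \<open>e \<le> 1\<close> the factor \<open>w powr (e - 1)\<close> is nonincreasing,
  so the derivative is largest in size at the left end \<open>a\<close>.\<close>

lemma powr_lipschitz_from:
  fixes a e t u :: real
  assumes "0 < a" "a \<le> t" "a \<le> u" "e \<le> 1"
  shows "\<bar>t powr e - u powr e\<bar> \<le> \<bar>e\<bar> * a powr (e - 1) * \<bar>t - u\<bar>"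
proof -
  have "norm (t powr e - u powr e) \<le> (\<bar>e\<bar> * a powr (e - 1)) * norm (t - u)"
  proof (rule field_differentiable_bound[where S="{a..}" and f'="\<lambda>w. e * w powr (e - 1)"])
    fix w assume w: "w \<in> {a..}"
    show "((\<lambda>w. w powr e) has_field_derivative e * w powr (e - 1)) (at w within {a..})"
      using w assms by (auto intro!: derivative_eq_intros simp: powr_diff)
    have "w powr (e - 1) \<le> a powr (e - 1)"
      using w assms by (intro powr_mono2') auto
    then show "norm (e * w powr (e - 1)) \<le> \<bar>e\<bar> * a powr (e - 1)"
      by (simp add: abs_mult mult_left_mono)
  qed (use assms in auto)
  then show ?thesis by simp
qed

lemma power_diff_le:
  fixes a b :: real
  assumes "0 \<le> b" "b \<le> a"
  shows "a ^ n - b ^ n \<le> real n * a ^ (n - 1) * (a - b)"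
proof (cases n)
  case (Suc m)
  have "a ^ n - b ^ n = (a - b) * (\<Sum>p<n. a ^ p * b ^ (m - p))"
    using power_diff_sumr2[of a n b] Suc by (simp add: mult.commute)
  also have "\<dots> \<le> (a - b) * (\<Sum>p<n. a ^ m)"
  proof (intro mult_left_mono sum_mono)
    fix p assume p: "p \<in> {..<n}"
    have "a ^ p * b ^ (m - p) \<le> a ^ p * a ^ (m - p)"
      using assms by (intro mult_left_mono power_mono) auto
    also have "\<dots> = a ^ m" using p Suc by (simp flip: power_add)
    finally show "a ^ p * b ^ (m - p) \<le> a ^ m" .
  qed (use assms in auto)
  finally show ?thesis using Suc by (simp add: ac_simps)
qed simp

text \<open>Linearity in the thickness \<open>b - a\<close> matters: the defect in the Kelvin
  argument lives in a shell of radius of order \<open>\<epsilon>\<close> but thickness of order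
  \<open>\<epsilon>\<^sup>2\<close>.\<close>

lemma measure_shell_le:
  fixes z :: "'a::euclidean_space"
  assumes "0 \<le> a" "a \<le> b"
  shows "measure lborel (cball z b - ball z a)
    \<le> unit_ball_vol (real DIM('a)) * (real DIM('a) * b ^ (DIM('a) - 1) * (b - a))"
proof -
  have "measure lborel (cball z b - ball z a) = measure lborel (cball z b) - measure lborel (ball z a)"
    using assms emeasure_bounded_finite[of "cball z b"]
    by (intro measure_Diff) auto
  also have "\<dots> = unit_ball_vol (real DIM('a)) * (b ^ DIM('a) - a ^ DIM('a))"
    using assms content_ball[of a z] content_cball[of b z]
    by (simp add: algebra_simps)
  also have "\<dots> \<le> unit_ball_vol (real DIM('a)) * (real DIM('a) * b ^ (DIM('a) - 1) * (b - a))"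
    using assms by (intro mult_left_mono power_diff_le unit_ball_vol_nonneg) auto
  finally show ?thesis .
qed

text \<open>
  The Kelvin transform in the sphere through \<open>z\<close> turns the contribution of the outside of that
  sphere to the principal value into minus the contribution of its inside.  Only the small ball
  removed around \<open>z\<close> is not invariant, and this defect is of order \<open>\<epsilon> powr (2 - 2 * s)\<close>.
\<close>

lemma has_frac_laplacian_norm_powr:
  fixes z :: "'a::euclidean_space"
  assumes n: "DIM('a) \<ge> 2" and s: "0 < s" "s < 1" and z: "z \<noteq> 0"
  shows "has_frac_laplacian s (\<lambda>y. norm y powr (2 * s - real DIM('a))) z 0"
proof -
  define n where "n = real DIM('a)"
  define e where "e = 2 * s - n"
  define R where "R = norm z"
  define g where "g y = (R powr e - norm y powr e) / norm (z - y) powr (n + 2 * s)" for y :: 'a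
  have R: "0 < R" using z by (simp add: R_def)
  have n2: "2 \<le> n" using n by (simp add: n_def)
  have e: "e < 0" using n2 s by (simp add: e_def)
  have g_measurable [measurable]: "g \<in> borel_measurable borel"
    unfolding g_def by measurable
  have int_g: "integrable lborel (\<lambda>y. indicator (- ball z \<epsilon>) y * g y)" if \<epsilon>: "0 < \<epsilon>" for \<epsilon>
  proof -
    \<comment> \<open>Two regions need a dominating function: infinity, where the kernel decays, and
      the pole at the origin, where the kernel is at most
      \<open>\<epsilon> powr - (n + 2 * s)\<close> and \<open>norm y powr e\<close> is integrable.
      The radius \<open>R/2\<close> separates them.\<close>
    let ?T = "\<lambda>y. indicator (- ball z \<epsilon>) y * norm (z - y) powr - (n + 2 * s)"
    let ?N = "\<lambda>y::'a. indicator (ball 0 (R/2)) y * norm y powr e"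
    define F where "F y = (R powr e + (R/2) powr e) * ?T y + \<epsilon> powr - (n + 2 * s) * ?N y" for y
    have "integrable lborel F"
      unfolding F_def using integrable_frac_tail[OF s(1) \<epsilon>, of z]
        integrable_norm_powr_near_zero[where 'a='a, of "2 * s" "R/2"] s
      by (intro Bochner_Integration.integrable_add Bochner_Integration.integrable_mult_right)
         (simp_all add: n_def e_def)
    then show ?thesis
    proof (rule Bochner_Integration.integrable_bound)
      show "AE y in lborel. norm (indicator (- ball z \<epsilon>) y * g y) \<le> norm (F y)"
      proof (rule AE_I2)
        fix y :: 'a
        show "norm (indicator (- ball z \<epsilon>) y * g y) \<le> norm (F y)"
        proof (cases "y \<in> ball z \<epsilon>")
          case False
          then have d: "\<epsilon> \<le> norm (z - y)" by (simp add: dist_norm)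
          define k where "k = norm (z - y) powr - (n + 2 * s)"
          have k: "0 \<le> k" "k \<le> \<epsilon> powr - (n + 2 * s)"
            unfolding k_def using d \<epsilon> n2 s by (auto intro!: powr_mono2')
          have gk: "g y = (R powr e - norm y powr e) * k"
            by (simp only: g_def k_def powr_minus divide_inverse)
          have "\<bar>R powr e - norm y powr e\<bar> \<le> R powr e + norm y powr e"
            using powr_ge_zero[of R e] powr_ge_zero[of "norm y" e] by linarith
          then have "\<bar>g y\<bar> \<le> R powr e * k + norm y powr e * k"
            unfolding gk using k(1)
            by (simp add: abs_mult distrib_right[symmetric] mult_right_mono)
          also have "norm y powr e * k \<le> (R/2) powr e * k + \<epsilon> powr - (n + 2 * s) * ?N y"
          proof (cases "norm y < R/2")
            case True
            then have "norm y powr e * k \<le> \<epsilon> powr - (n + 2 * s) * ?N y"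
              using mult_left_mono[OF k(2), of "norm y powr e"] by (simp add: mult.commute)
            then show ?thesis using k(1) by (simp add: add_increasing)
          next
            case False
            then have "norm y powr e \<le> (R/2) powr e"
              using R e by (intro powr_mono2') auto
            then show ?thesis using k(1) False by (simp add: mult_right_mono)
          qed
          finally have "\<bar>g y\<bar> \<le> F y"
            using False by (simp add: F_def k_def algebra_simps)
          then show ?thesis using False by simp
        qed simp
      qed
    qed measurable
  qed
  \<comment> \<open>With the factor \<open>norm y powr n\<close> that compensates the invariant
    weight, the integrand is odd under inversion. The exponent \<open>e = 2 * s - n\<close> is what
    makes the powers match.\<close>
  have g_inv: "norm (sphere_inv R y) powr n * g (sphere_inv R y) = - (norm y powr n * g y)"
    if y: "y \<noteq> 0" for y
  proof -
    define N where "N = norm y"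
    define D where "D = norm (z - y)"
    have N: "0 < N" using y by (simp add: N_def)
    have 1: "norm (sphere_inv R y) = R * (R / N)"
      by (simp add: norm_sphere_inv N_def power2_eq_square)
    have 2: "norm (z - sphere_inv R y) = R / N * D"
      using dist_sphere_inv[OF y, of z] by (simp add: R_def N_def D_def)
    \<comment> \<open>In terms of logarithms the identity between powers becomes a linear identity
      between exponents.\<close>
    define r where "r = ln R"
    define v where "v = ln N"
    have Rx: "R = exp r" and Nx: "N = exp v" using R N by (simp_all add: r_def v_def)
    have px: "exp t powr c = exp (c * t)" for t c :: real by (simp add: powr_def)
    have RN: "R / N = exp (r - v)" "R * (R / N) = exp (2 * r - v)"
      by (simp_all add: Rx Nx exp_diff exp_double power2_eq_square)
    have "norm (sphere_inv R y) powr n * g (sphere_inv R y)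
      = exp (n * (2 * r - v)) * (exp (e * r) - exp (e * (2 * r - v)))
          / (exp ((n + 2 * s) * (r - v)) * D powr (n + 2 * s))"
      unfolding g_def 1 2 unfolding RN(2) unfolding RN(1) by (simp add: powr_mult px Rx)
    also have "\<dots> = exp (n * (2 * r - v)) * (exp (e * r) - exp (e * (2 * r - v)))
          / exp ((n + 2 * s) * (r - v)) / D powr (n + 2 * s)"
      by simp
    also have "exp (n * (2 * r - v)) * (exp (e * r) - exp (e * (2 * r - v))) / exp ((n + 2 * s) * (r - v))
        = exp (n * v) * (exp (e * v) - exp (e * r))"
    proof -
      have "n * (2 * r - v) + e * r = n * v + e * v + (n + 2 * s) * (r - v)"
        "n * (2 * r - v) + e * (2 * r - v) = n * v + e * r + (n + 2 * s) * (r - v)"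
        by (simp_all add: e_def algebra_simps)
      then have "exp (n * (2 * r - v)) * exp (e * r) = exp (n * v) * exp (e * v) * exp ((n + 2 * s) * (r - v))"
        "exp (n * (2 * r - v)) * exp (e * (2 * r - v)) = exp (n * v) * exp (e * r) * exp ((n + 2 * s) * (r - v))"
        by (simp_all only: exp_add[symmetric])
      then show ?thesis by (simp add: right_diff_distrib diff_divide_distrib)
    qed
    also have "exp (n * v) * (exp (e * v) - exp (e * r)) / D powr (n + 2 * s) = - (norm y powr n * g y)"
      unfolding g_def N_def[symmetric] D_def[symmetric] Rx Nx px
      by (simp add: right_diff_distrib diff_divide_distrib)
    finally show ?thesis .
  qed
  \<comment> \<open>The factors are the Lipschitz constant of the power on radii at least
    \<open>R/2\<close>, the kernel at distance at least \<open>\<epsilon>/2\<close>, and the volume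
    of a shell of outer radius at most \<open>3/2 * \<epsilon>\<close> and thickness at most
    \<open>3/R * \<epsilon>\<^sup>2\<close>.\<close>
  define C where "C = \<bar>e\<bar> * (R/2) powr (e - 1) * (1/2) powr (1 - n - 2 * s)
    * (unit_ball_vol n * (n * (3/2) ^ (DIM('a) - 1) * (3 / R)))"
  have bound: "\<bar>\<integral>y. indicator (- ball z \<epsilon>) y * g y \<partial>lborel\<bar> \<le> C * \<epsilon> powr (2 - 2 * s)"
    if \<epsilon>: "0 < \<epsilon>" "\<epsilon> \<le> R / 3" for \<epsilon>
  proof -
    define A where "A = - ball z \<epsilon>"
    have A[measurable]: "A \<in> sets borel" by (simp add: A_def)
    \<comment> \<open>Multiplying by \<open>norm y powr n\<close> brings the integral into the form
      required by \<open>integral_sphere_inv\<close>.\<close>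
    define q where "q y = indicator A y * (norm y powr n * g y)" for y
    have q_measurable[measurable]: "q \<in> borel_measurable borel" unfolding q_def by measurable
    have AE0: "AE y in lborel. y \<noteq> (0::'a)" by (rule AE_lborel_singleton)
    have ae1: "AE y in lborel. norm y powr - n * q y = indicator A y * g y"
      using AE0 by eventually_elim (simp add: q_def powr_add[symmetric] mult.assoc[symmetric])
    have ae2: "AE y in lborel. norm y powr - n * q (sphere_inv R y) = - (indicator A (sphere_inv R y) * g y)"
      using AE0 by eventually_elim (simp add: q_def g_inv powr_add[symmetric] mult.assoc[symmetric])
    have i1: "integrable lborel (\<lambda>y. norm y powr - n * q y)"
      using int_g[OF \<epsilon>(1)] ae1 by (subst integrable_cong_AE[OF _ _ ae1]) (auto simp: A_def)
    have i2: "integrable lborel (\<lambda>y. norm y powr - n * q (sphere_inv R y))"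
      using integrable_sphere_inv[OF q_measurable R] i1 by (simp add: n_def)
    have i3: "integrable lborel (\<lambda>y. indicator A (sphere_inv R y) * g y)"
      using i2 by (subst (asm) integrable_cong_AE[OF _ _ ae2]) auto
    have "(\<integral>y. indicator A y * g y \<partial>lborel) = (\<integral>y. norm y powr - n * q y \<partial>lborel)"
      by (intro integral_cong_AE) (use ae1 in auto)
    also have "\<dots> = (\<integral>y. norm y powr - n * q (sphere_inv R y) \<partial>lborel)"
      using integral_sphere_inv[OF q_measurable R] by (simp add: n_def)
    also have "\<dots> = - (\<integral>y. indicator A (sphere_inv R y) * g y \<partial>lborel)"
      by (subst integral_cong_AE[OF _ _ ae2]) auto
    \<comment> \<open>Oddness makes the integral over \<open>A\<close> minus the integral over the
      inverse of \<open>A\<close>. Hence twice the integral only sees the points at which the two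
      sets differ.\<close>
    finally have "2 * (\<integral>y. indicator A y * g y \<partial>lborel)
      = (\<integral>y. indicator A y * g y \<partial>lborel) - (\<integral>y. indicator A (sphere_inv R y) * g y \<partial>lborel)"
      by simp
    also have "\<dots> = (\<integral>y. (indicator A y - indicator A (sphere_inv R y)) * g y \<partial>lborel)"
      using int_g[OF \<epsilon>(1)] i3
      by (subst Bochner_Integration.integral_diff[symmetric]) (simp_all add: A_def left_diff_distrib)
    finally have twice: "2 * (\<integral>y. indicator A y * g y \<partial>lborel)
      = (\<integral>y. (indicator A y - indicator A (sphere_inv R y)) * g y \<partial>lborel)" .
    \<comment> \<open>Membership in the inverted set compares \<open>R * norm (z - y)\<close> with
      \<open>\<epsilon> * norm y\<close>, and \<open>norm y\<close> lies between
      \<open>R - norm (z - y)\<close> and \<open>R + norm (z - y)\<close>. The extreme radii solve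
      \<open>R * a = \<epsilon> * (R - a)\<close> and
      \<open>R * b = \<epsilon> * (R + b)\<close>.\<close>
    define a where "a = \<epsilon> * R / (R + \<epsilon>)"
    define b where "b = \<epsilon> * R / (R - \<epsilon>)"
    define M where "M = \<bar>e\<bar> * (R/2) powr (e - 1) * (\<epsilon>/2) powr (1 - n - 2 * s)"
    have Re: "0 < R - \<epsilon>" using \<epsilon> R by simp
    have a: "\<epsilon> / 2 \<le> a" "a \<le> \<epsilon>" using \<epsilon> R by (simp_all add: a_def field_simps)
    have b: "\<epsilon> \<le> b" "b \<le> 3/2 * \<epsilon>" "b \<le> R/2" 
      using \<epsilon> R Re by (simp_all add: b_def field_simps)
    have M0: "0 \<le> M" by (simp add: M_def)
    have ptw: "AE y in lborel. \<bar>(indicator A y - indicator A (sphere_inv R y)) * g y\<bar>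
        \<le> M * indicator (cball z b - ball z a) y"
      using AE0
    proof eventually_elim
      fix y :: 'a assume y: "y \<noteq> 0"
      have inA: "(y \<in> A) = (\<epsilon> \<le> norm (z - y))"
        by (auto simp: A_def dist_norm)
      have inA': "(sphere_inv R y \<in> A) = (\<epsilon> * norm y \<le> R * norm (z - y))"
        unfolding A_def R_def
        by (simp add: dist_norm dist_sphere_inv[OF y] linorder_not_less) (use y in \<open>simp add: field_simps\<close>)
      have ny: "norm y \<le> R + norm (z - y)" "R - norm (z - y) \<le> norm y"
        using norm_triangle_sub[of y z] norm_triangle_sub[of z y] by (simp_all add: R_def norm_minus_commute)
      show "\<bar>(indicator A y - indicator A (sphere_inv R y)) * g y\<bar>
        \<le> M * indicator (cball z b - ball z a) y"
      proof (cases "(y \<in> A) = (sphere_inv R y \<in> A)")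
        case True
        then show ?thesis using M0 by (simp add: indicator_def)
      next
        case False
        have "a \<le> norm (z - y) \<and> norm (z - y) \<le> b"
        proof (cases "y \<in> A")
          case True
          then have "R * norm (z - y) < \<epsilon> * norm y" using False inA' by auto
          also have "\<dots> \<le> \<epsilon> * (R + norm (z - y))" using ny \<epsilon> by (intro mult_left_mono) auto
          finally have "norm (z - y) \<le> b" using Re by (simp add: b_def field_simps)
          then show ?thesis using True inA a by auto
        next
          case F: False
          have "\<epsilon> * (R - norm (z - y)) \<le> \<epsilon> * norm y" using ny \<epsilon> by (intro mult_left_mono) auto
          also have "\<dots> \<le> R * norm (z - y)" using F False inA' by auto
          finally have "a \<le> norm (z - y)" using R \<epsilon> by (simp add: a_def field_simps)
          then show ?thesis using F inA b by auto
        qed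
        note d = this
        then have pos: "0 < norm (z - y)" using a \<epsilon> by linarith
        have "R / 2 \<le> norm y" using d b ny by linarith
        \<comment> \<open>The numerator of \<open>g\<close> vanishes to first order at
          \<open>z\<close>, which removes one power of \<open>norm (z - y)\<close> from the
          kernel.\<close>
        then have "\<bar>R powr e - norm y powr e\<bar> \<le> \<bar>e\<bar> * (R/2) powr (e - 1) * \<bar>R - norm y\<bar>"
          using R e by (intro powr_lipschitz_from) auto
        also have "\<dots> \<le> \<bar>e\<bar> * (R/2) powr (e - 1) * norm (z - y)"
          using ny by (intro mult_left_mono) auto
        finally have "\<bar>g y\<bar> \<le> \<bar>e\<bar> * (R/2) powr (e - 1) * norm (z - y) / norm (z - y) powr (n + 2 * s)"
          by (simp add: g_def divide_right_mono)
        also have "\<dots> = \<bar>e\<bar> * (R/2) powr (e - 1) * norm (z - y) powr (1 - n - 2 * s)"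
          using pos by (simp add: powr_diff powr_add)
        also have "\<dots> \<le> M" unfolding M_def
          using d a \<epsilon> n2 s by (intro mult_left_mono powr_mono2') auto
        finally have "\<bar>g y\<bar> \<le> M" .
        moreover have "y \<in> cball z b - ball z a" using d by (simp add: dist_norm)
        ultimately show ?thesis using False by (auto simp: indicator_def)
      qed
    qed
    have fin: "integrable lborel (\<lambda>y. M * indicator (cball z b - ball z a) y)"
      using emeasure_bounded_finite[of "cball z b - ball z a"]
      by (intro Bochner_Integration.integrable_mult_right integrable_real_indicator) auto
    have "\<bar>\<integral>y. (indicator A y - indicator A (sphere_inv R y)) * g y \<partial>lborel\<bar>
      \<le> (\<integral>y. \<bar>(indicator A y - indicator A (sphere_inv R y)) * g y\<bar> \<partial>lborel)"
      by (rule integral_abs_bound)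
    also have "\<dots> \<le> (\<integral>y. M * indicator (cball z b - ball z a) y \<partial>lborel)"
      by (rule integral_mono_AE'[OF fin ptw]) (use M0 in simp)
    also have "\<dots> = M * measure lborel (cball z b - ball z a)" by simp
    also have "\<dots> \<le> M * (unit_ball_vol n * (n * b ^ (DIM('a) - 1) * (b - a)))"
      using measure_shell_le[of a b z] a b \<epsilon> M0 by (intro mult_left_mono) (auto simp: n_def)
    also have "\<dots> \<le> M * (unit_ball_vol n * (n * (3/2 * \<epsilon>) ^ (DIM('a) - 1) * (3 / R * \<epsilon>\<^sup>2)))"
    proof -
      \<comment> \<open>Both radii agree with \<open>\<epsilon>\<close> to first order, so the
        thickness is quadratic in \<open>\<epsilon>\<close>; this is the power that beats the
        singularity.\<close>
      have "b - a = \<epsilon>\<^sup>2 * (2 * R / (R\<^sup>2 - \<epsilon>\<^sup>2))"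
        using R Re \<epsilon> by (simp add: a_def b_def field_simps power2_eq_square)
      also have "2 * R / (R\<^sup>2 - \<epsilon>\<^sup>2) \<le> 3 / R"
      proof -
        have "\<epsilon>\<^sup>2 \<le> (R/3)\<^sup>2" using \<epsilon> by (intro power_mono) auto
        then have "9 * \<epsilon>\<^sup>2 \<le> R\<^sup>2" by (simp add: power_divide)
        moreover have "0 < \<epsilon>\<^sup>2" using \<epsilon> by simp
        ultimately have h: "3 * \<epsilon>\<^sup>2 \<le> R\<^sup>2" "\<epsilon>\<^sup>2 < R\<^sup>2" by linarith+
        then show ?thesis using R by (simp add: field_simps power2_eq_square)
      qed
      finally have "b - a \<le> 3 / R * \<epsilon>\<^sup>2" using \<epsilon> by (simp add: mult_left_mono mult.commute)
      moreover have "b ^ (DIM('a) - 1) \<le> (3/2 * \<epsilon>) ^ (DIM('a) - 1)"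
        using b \<epsilon> by (intro power_mono) auto
      ultimately show ?thesis
        using M0 a b \<epsilon> n2 by (intro mult_left_mono mult_mono mult_nonneg_nonneg) auto
    qed
    also have "\<dots> = C * \<epsilon> powr (2 - 2 * s)"
    proof -
      have "\<epsilon> ^ (DIM('a) - 1) = \<epsilon> powr (n - 1)"
        using \<epsilon> n by (simp add: n_def powr_realpow[symmetric] of_nat_diff)
      then have "(\<epsilon>/2) powr (1 - n - 2 * s) * (\<epsilon> ^ (DIM('a) - 1) * \<epsilon>\<^sup>2)
          = (1/2) powr (1 - n - 2 * s) * (\<epsilon> powr (1 - n - 2 * s) * \<epsilon> powr (n - 1) * \<epsilon> powr 2)"
        using \<epsilon> powr_mult[of \<epsilon> "1/2" "1 - n - 2 * s"] by (simp add: powr_numeral)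
      also have "\<dots> = (1/2) powr (1 - n - 2 * s) * \<epsilon> powr (2 - 2 * s)"
        by (simp add: powr_add[symmetric])
      finally have "(\<epsilon>/2) powr (1 - n - 2 * s) * (\<epsilon> ^ (DIM('a) - 1) * \<epsilon>\<^sup>2)
          = (1/2) powr (1 - n - 2 * s) * \<epsilon> powr (2 - 2 * s)" .
      then show ?thesis
        unfolding M_def C_def power_mult_distrib by (simp add: ac_simps)
    qed
    finally have "\<bar>2 * (\<integral>y. indicator A y * g y \<partial>lborel)\<bar> \<le> C * \<epsilon> powr (2 - 2 * s)"
      unfolding twice .
    then show ?thesis by (simp add: A_def)
  qed
  have "((\<lambda>\<epsilon>. \<integral>y. indicator (- ball z \<epsilon>) y * g y \<partial>lborel) \<longlongrightarrow> 0) (at_right 0)"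
  proof (rule Lim_null_comparison)
    show "\<forall>\<^sub>F \<epsilon> in at_right 0. norm (\<integral>y. indicator (- ball z \<epsilon>) y * g y \<partial>lborel) \<le> C * \<epsilon> powr (2 - 2 * s)"
      using R bound by (intro eventually_at_rightI[of 0 "R/3"]) auto
    have "((\<lambda>\<epsilon>. \<epsilon> powr (2 - 2 * s)) \<longlongrightarrow> 0) (at_right (0::real))"
      using s by (intro tendsto_eq_intros) (auto intro!: tendsto_ident_at eventually_at_rightI[of 0 1])
    from tendsto_mult_right_zero[OF this]
    show "((\<lambda>\<epsilon>. C * \<epsilon> powr (2 - 2 * s)) \<longlongrightarrow> 0) (at_right (0::real))" .
  qed
  from tendsto_mult_right_zero[OF this, of "frac_const TYPE('a) s"]
  show ?thesis
    unfolding has_frac_laplacian_def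
    using int_g set_integrable_lebesgue_borel[OF g_measurable] set_integral_lebesgue_borel[OF g_measurable]
    by (simp add: g_def[abs_def] R_def e_def n_def)
qed

section \<open>The maximum principle\<close>

lemma has_frac_laplacian_const: "has_frac_laplacian s (\<lambda>_. m) z 0"
  by (simp add: has_frac_laplacian_def set_integrable_def set_lebesgue_integral_def)

lemma has_frac_laplacian_reflect:
  fixes h :: "'a::euclidean_space \<Rightarrow> real"
  assumes [measurable]: "h \<in> borel_measurable borel"
    and h: "has_frac_laplacian s h w l"
  shows "has_frac_laplacian s (\<lambda>y. c * h (x - y)) (x - w) (c * l)"
proof -
  define g where "g y = (h w - h y) / norm (w - y) powr (real DIM('a) + 2 * s)" for y
  have [measurable]: "g \<in> borel_measurable borel" unfolding g_def by measurable
  have eq: "indicator (- ball (x - w) \<epsilon>) y * ((c * h w - c * h (x - y)) / norm (x - w - y) powr (real DIM('a) + 2 * s))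
    = c * (indicator (- ball w \<epsilon>) (x - y) * g (x - y))" for \<epsilon> y
  proof -
    have "norm (x - w - y) = norm (w - (x - y))"
      by (metis diff_diff_eq2 add.commute diff_diff_add norm_minus_commute)
    then show ?thesis by (simp add: g_def dist_norm indicator_def right_diff_distrib)
  qed
  have m: "(\<lambda>y. indicator (- ball w \<epsilon>) y * g y) \<in> borel_measurable borel" for \<epsilon>
    by measurable
  have b: "(\<lambda>y. (c * h w - c * h (x - y)) / norm (x - w - y) powr (real DIM('a) + 2 * s)) \<in> borel_measurable borel"
    "- ball (x - w) \<epsilon> \<in> sets borel" "- ball w \<epsilon> \<in> sets borel" for \<epsilon>
    by measurable
  have 1: "set_integrable lebesgue (- ball (x - w) \<epsilon>)
      (\<lambda>y. (c * h w - c * h (x - y)) / norm (x - w - y) powr (real DIM('a) + 2 * s))" if "0 < \<epsilon>" for \<epsilon>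
  proof -
    have "set_integrable lebesgue (- ball w \<epsilon>) g"
      using h that by (simp add: has_frac_laplacian_def g_def[abs_def])
    then have "integrable lborel (\<lambda>y. indicator (- ball w \<epsilon>) (x - y) * g (x - y))"
      by (simp add: set_integrable_lebesgue_borel integrable_reflect[OF m])
    then show ?thesis
      unfolding set_integrable_lebesgue_borel[OF b(1,2)] eq
      by (rule Bochner_Integration.integrable_mult_right)
  qed
  have 2: "(LINT y:- ball (x - w) \<epsilon>|lebesgue. (c * h w - c * h (x - y)) / norm (x - w - y) powr (real DIM('a) + 2 * s))
      = c * (LINT y:- ball w \<epsilon>|lebesgue. g y)" for \<epsilon>
    unfolding set_integral_lebesgue_borel[OF b(1,2)] eq
    by (simp add: integral_reflect[OF m] set_integral_lebesgue_borel)
  have "((\<lambda>\<epsilon>. c * (frac_const TYPE('a) s * (LINT y:- ball w \<epsilon>|lebesgue. g y))) \<longlongrightarrow> c * l) (at_right 0)"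
    using h by (intro tendsto_mult_left) (simp add: has_frac_laplacian_def g_def[abs_def])
  then show ?thesis
    unfolding has_frac_laplacian_def using 1 by (simp add: 2 mult.left_commute)
qed

lemma has_frac_laplacian_minus:
  assumes "has_frac_laplacian s h z 0"
  shows "has_frac_laplacian s (\<lambda>y. - h y) z 0"
proof -
  have *: "(- h z - - h y) / k = - ((h z - h y) / k)" for y k
    by (simp add: divide_simps)
  show ?thesis
    using assms tendsto_minus[of "\<lambda>\<epsilon>. frac_const TYPE('a) s *
          (LINT y : - ball z \<epsilon> | lebesgue. (h z - h y) / norm (z - y) powr (real DIM('a) + 2 * s))" 0]
    unfolding has_frac_laplacian_def *
    by (simp add: set_integrable_def set_lebesgue_integral_def)
qed

lemma frac_const_pos:
  assumes "0 < s" "s < 1"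
  shows "0 < frac_const TYPE('a::euclidean_space) s"
  unfolding frac_const_def using assms
  by (auto intro!: mult_pos_pos divide_pos_pos Gamma_real_pos add_pos_pos)

text \<open>The hypotheses say that \<open>h - \<phi>\<close> is maximal at \<open>z\<close> and
  smaller by at least \<open>c\<close> far away. The kernel is positive, so every truncated integral
  of \<open>h\<close> exceeds that of \<open>\<phi>\<close> by a fixed amount \<open>J\<close>, and
  the two limits cannot both be zero.\<close>

lemma frac_laplacian_no_touching:
  fixes h \<phi> :: "'a::euclidean_space \<Rightarrow> real"
  assumes s: "0 < s" "s < 1"
    and h: "has_frac_laplacian s h z 0" and \<phi>: "has_frac_laplacian s \<phi> z 0"
    and le: "AE y in lebesgue. \<phi> z - \<phi> y \<le> h z - h y"
    and \<rho>: "0 < \<rho>" and c: "0 < c"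
    and far: "\<And>y. y \<notin> ball z \<rho> \<Longrightarrow> c + (\<phi> z - \<phi> y) \<le> h z - h y"
  shows False
proof -
  define k where "k y = norm (z - y) powr (real DIM('a) + 2 * s)" for y
  let ?I = "\<lambda>f \<epsilon>. LINT y : - ball z \<epsilon> | lebesgue. (f z - f y) / k y"
  let ?B = "frac_const TYPE('a) s"
  have B: "0 < ?B" by (rule frac_const_pos[OF s])
  obtain b :: 'a where b: "norm b = 1" using norm_Basis nonempty_Basis by blast
  \<comment> \<open>The unit ball around \<open>q\<close> lies between the radii
    \<open>\<rho>\<close> and \<open>\<rho> + 2\<close> around \<open>z\<close>. There the gap
    \<open>c\<close> is available, the kernel is bounded below, and truncation at
    \<open>\<epsilon> < \<rho>\<close> removes nothing.\<close>
  define q where "q = z + (\<rho> + 1) *\<^sub>R b"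
  have zq: "norm (z - q) = \<rho> + 1" using b \<rho> by (simp add: q_def)
  define J where "J = c / (\<rho> + 2) powr (real DIM('a) + 2 * s) * measure lebesgue (ball q 1)"
  have "0 < measure lebesgue (ball q 1)" by (simp add: content_ball_pos)
  then have J: "0 < J" unfolding J_def using c \<rho> by (intro mult_pos_pos divide_pos_pos) auto
  have iq: "integrable lebesgue (\<lambda>y. c / (\<rho> + 2) powr (real DIM('a) + 2 * s) * indicator (ball q 1) y)"
    by (intro Bochner_Integration.integrable_mult_right integrable_real_indicator)
      (use emeasure_bounded_finite[of "ball q 1"] in auto)
  have step: "?I \<phi> \<epsilon> + J \<le> ?I h \<epsilon>" if \<epsilon>: "0 < \<epsilon>" "\<epsilon> < \<rho>" for \<epsilon>
  proof -
    have ih: "integrable lebesgue (\<lambda>y. indicator (- ball z \<epsilon>) y * ((h z - h y) / k y))"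
      and i\<phi>: "integrable lebesgue (\<lambda>y. indicator (- ball z \<epsilon>) y * ((\<phi> z - \<phi> y) / k y))"
      using h \<phi> \<epsilon>(1) by (simp_all add: has_frac_laplacian_def k_def set_integrable_def)
    have "?I \<phi> \<epsilon> + J = (\<integral>y. indicator (- ball z \<epsilon>) y * ((\<phi> z - \<phi> y) / k y)
        + c / (\<rho> + 2) powr (real DIM('a) + 2 * s) * indicator (ball q 1) y \<partial>lebesgue)"
      by (subst Bochner_Integration.integral_add[OF i\<phi> iq])
        (simp add: set_lebesgue_integral_def J_def)
    also have "\<dots> \<le> (\<integral>y. indicator (- ball z \<epsilon>) y * ((h z - h y) / k y) \<partial>lebesgue)"
    proof (rule integral_mono_AE[OF Bochner_Integration.integrable_add[OF i\<phi> iq] ih])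
      show "AE y in lebesgue. indicator (- ball z \<epsilon>) y * ((\<phi> z - \<phi> y) / k y)
        + c / (\<rho> + 2) powr (real DIM('a) + 2 * s) * indicator (ball q 1) y
        \<le> indicator (- ball z \<epsilon>) y * ((h z - h y) / k y)"
        using le
      proof eventually_elim
        case (elim y)
        show ?case
        proof (cases "y \<in> ball q 1")
          case True
          then have d: "norm (z - y) < \<rho> + 2" "\<rho> < norm (z - y)"
            using zq norm_triangle_ineq[of "z - q" "q - y"] norm_triangle_ineq[of "z - y" "y - q"]
            by (auto simp: dist_norm norm_minus_commute)
          then have kp: "0 < k y" "k y \<le> (\<rho> + 2) powr (real DIM('a) + 2 * s)"
            unfolding k_def using \<rho> s by (auto intro!: powr_mono2)
          have "c / (\<rho> + 2) powr (real DIM('a) + 2 * s) \<le> c / k y"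
            using kp c by (intro divide_left_mono) (auto intro!: mult_pos_pos)
          moreover have "(c + (\<phi> z - \<phi> y)) / k y \<le> (h z - h y) / k y"
            using far[of y] d kp by (intro divide_right_mono) (auto simp: dist_norm)
          moreover have "y \<in> - ball z \<epsilon>" using d \<epsilon> by (simp add: dist_norm)
          ultimately show ?thesis using True by (simp add: add_divide_distrib)
        next
          case False
          have "0 \<le> k y" by (simp add: k_def)
          then show ?thesis using elim False by (simp add: indicator_def divide_right_mono)
        qed
      qed
    qed
    also have "\<dots> = ?I h \<epsilon>" by (simp add: set_lebesgue_integral_def)
    finally show ?thesis .
  qed
  have lh: "((\<lambda>\<epsilon>. ?B * ?I h \<epsilon>) \<longlongrightarrow> 0) (at_right 0)"
    and l\<phi>: "((\<lambda>\<epsilon>. ?B * ?I \<phi> \<epsilon>) \<longlongrightarrow> 0) (at_right 0)"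
    using h \<phi> by (simp_all add: has_frac_laplacian_def k_def)
  have "((\<lambda>\<epsilon>. ?B * ?I \<phi> \<epsilon> + ?B * J) \<longlongrightarrow> 0 + ?B * J) (at_right 0)"
    by (intro tendsto_add l\<phi> tendsto_const)
  then have "0 + ?B * J \<le> 0"
  proof (rule tendsto_le[OF _ lh, rotated])
    show "\<forall>\<^sub>F \<epsilon> in at_right 0. ?B * ?I \<phi> \<epsilon> + ?B * J \<le> ?B * ?I h \<epsilon>"
    proof (rule eventually_at_rightI[of 0 \<rho>])
      fix \<epsilon> assume "\<epsilon> \<in> {0<..<\<rho>}"
      then have "?B * (?I \<phi> \<epsilon> + J) \<le> ?B * ?I h \<epsilon>"
        using step[of \<epsilon>] B by (intro mult_left_mono) auto
      then show "?B * ?I \<phi> \<epsilon> + ?B * J \<le> ?B * ?I h \<epsilon>" by (simp add: distrib_left)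
    qed (rule \<rho>)
  qed simp
  then show False using mult_pos_pos[OF B J] by simp
qed

text \<open>
  \<open>N\<close> is the set of poles of \<open>\<phi>\<close>; the comparison near the poles is a hypothesis because the maximum
  of \<open>h - \<phi>\<close> must be attained away from them.
\<close>

lemma frac_comparison:
  fixes h \<phi> :: "'a::euclidean_space \<Rightarrow> real"
  assumes s: "0 < s" "s < 1" and \<Omega>: "bounded \<Omega>" "open \<Omega>"
    and U: "open U" "N \<subseteq> U" and N: "AE y in lebesgue. y \<notin> N"
    and h: "continuous_on UNIV h" "\<And>y. y \<in> \<Omega> \<Longrightarrow> has_frac_laplacian s h y 0"
    and \<phi>: "continuous_on (- N) \<phi>" "\<And>y. y \<in> \<Omega> - N \<Longrightarrow> has_frac_laplacian s \<phi> y 0"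
    and out: "\<And>y. y \<notin> \<Omega> \<Longrightarrow> h y \<le> \<phi> y" and near: "\<And>y. y \<in> U - N \<Longrightarrow> h y \<le> \<phi> y"
    and y: "y \<notin> N"
  shows "h y \<le> \<phi> y"
proof (rule ccontr)
  assume less: "\<not> h y \<le> \<phi> y"
  \<comment> \<open>Removing the open set \<open>U\<close> keeps \<open>S\<close> compact and away
    from the poles, so the difference attains its maximum on \<open>S\<close>; off \<open>S\<close>
    and the poles it is not positive.\<close>
  define S where "S = closure \<Omega> - U"
  have "y \<in> \<Omega>" "y \<notin> U" using less out near y by auto
  then have yS: "y \<in> S" using closure_subset by (auto simp: S_def)
  have "compact S" unfolding S_def using \<Omega>(1) U(1) by (intro compact_diff) auto
  moreover have "continuous_on S (\<lambda>y. h y - \<phi> y)"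
    using U(2) by (intro continuous_on_diff continuous_on_subset[OF h(1)] continuous_on_subset[OF \<phi>(1)])
      (auto simp: S_def)
  ultimately obtain z where z: "z \<in> S" and max: "\<And>y. y \<in> S \<Longrightarrow> h y - \<phi> y \<le> h z - \<phi> z"
    using continuous_attains_sup[of S "\<lambda>y. h y - \<phi> y"] yS by blast
  have pos: "0 < h z - \<phi> z" using max[OF yS] less by simp
  then have z\<Omega>: "z \<in> \<Omega>" using out[of z] by force
  have zN: "z \<notin> N" using z U(2) by (auto simp: S_def)
  have le: "h y - \<phi> y \<le> h z - \<phi> z" if "y \<notin> N" for y
  proof (cases "y \<in> S")
    case False
    then have "y \<notin> \<Omega> \<or> y \<in> U - N" using that closure_subset[of \<Omega>] by (auto simp: S_def)
    then have "h y - \<phi> y \<le> 0" using out[of y] near[of y] by auto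
    then show ?thesis using pos by simp
  qed (rule max)
  \<comment> \<open>Beyond \<open>\<rho>\<close> all points are outside \<open>\<Omega>\<close>,
    where \<open>h \<le> \<phi>\<close>, so the gap there is the full maximum
    \<open>h z - \<phi> z\<close>.\<close>
  obtain \<rho> where \<rho>: "0 < \<rho>" "\<Omega> \<subseteq> ball z \<rho>" using bounded_subset_ballD[OF \<Omega>(1)] by blast
  show False
  proof (rule frac_laplacian_no_touching[OF s h(2)[OF z\<Omega>] \<phi>(2) _ \<rho>(1) pos])
    show "z \<in> \<Omega> - N" using z\<Omega> zN by simp
    show "AE y in lebesgue. \<phi> z - \<phi> y \<le> h z - h y"
      using N by eventually_elim (use le in force)
    show "h z - \<phi> z + (\<phi> z - \<phi> y) \<le> h z - h y" if "y \<notin> ball z \<rho>" for y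
      using out[of y] that \<rho>(2) by force
  qed
qed

section \<open>Bounds for Green's kernel\<close>

definition riesz_const :: "'a::euclidean_space itself \<Rightarrow> real \<Rightarrow> real" where
  "riesz_const _ s =
     Gamma (real DIM('a) / 2 - s) / (pi powr (real DIM('a) / 2) * Gamma (2 + s)) * s * (1 + s)"

lemma fundamental_solution_eq:
  "fundamental_solution s (x::'a::euclidean_space) =
     riesz_const TYPE('a) s * norm x powr (2 * s - real DIM('a))"
  by (simp add: fundamental_solution_def riesz_const_def)

lemma riesz_const_pos:
  assumes "DIM('a::euclidean_space) \<ge> 2" "0 < s" "s < 1"
  shows "0 < riesz_const TYPE('a) s"
  unfolding riesz_const_def using assms
  by (auto intro!: mult_pos_pos divide_pos_pos Gamma_real_pos)

lemma has_frac_laplacian_fundamental_solution: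
  fixes x z :: "'a::euclidean_space"
  assumes "DIM('a) \<ge> 2" "0 < s" "s < 1" "z \<noteq> x"
  shows "has_frac_laplacian s (\<lambda>y. fundamental_solution s (x - y)) z 0"
  using has_frac_laplacian_reflect[OF _ has_frac_laplacian_norm_powr[of s "x - z"],
      of "riesz_const TYPE('a) s" x] assms
  by (simp add: fundamental_solution_eq)

section \<open>Distance to the boundary, test functions, measurability\<close>

text \<open>The segment from \<open>x\<close> to \<open>y\<close> leaves \<open>\<Omega>\<close> and
  therefore meets the frontier no farther away than \<open>y\<close>.\<close>

lemma infdist_frontier_le:
  fixes x y :: "'a::euclidean_space"
  assumes "x \<in> \<Omega>" "y \<notin> \<Omega>"
  shows "infdist x (frontier \<Omega>) \<le> norm (x - y)"
proof -
  have "closed_segment x y \<inter> frontier \<Omega> \<noteq> {}"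
    using assms by (intro connected_Int_frontier) (auto intro: ends_in_segment)
  then obtain w where w: "w \<in> closed_segment x y" "w \<in> frontier \<Omega>" by blast
  have "infdist x (frontier \<Omega>) \<le> dist x w" using w(2) by (rule infdist_le)
  also have "\<dots> \<le> dist x y" using w(1) by (metis segment_bound(1) dist_commute dist_norm)
  finally show ?thesis by (simp add: dist_norm)
qed

lemma infdist_frontier_pos:
  fixes \<Omega> :: "'a::euclidean_space set"
  assumes "open \<Omega>" "frontier \<Omega> \<noteq> {}" "x \<in> \<Omega>"
  shows "0 < infdist x (frontier \<Omega>)"
  using assms by (metis IntI disjoint_iff frontier_disjoint_eq frontier_closed infdist_pos_not_in_closed)

lemma cball_subset_domain:
  fixes x :: "'a::euclidean_space"
  assumes "x \<in> \<Omega>" "r < infdist x (frontier \<Omega>)"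
  shows "cball x r \<subseteq> \<Omega>"
proof
  fix y assume "y \<in> cball x r"
  then have "norm (x - y) < infdist x (frontier \<Omega>)" using assms(2) by (simp add: dist_norm)
  then show "y \<in> \<Omega>" using infdist_frontier_le[OF assms(1)] by force
qed

lemma indicator_in_Linf_c:
  assumes "compact B" "B \<subseteq> \<Omega>"
  shows "indicator B \<in> Linf_c \<Omega>"
proof -
  have "B \<in> sets lebesgue" using assms(1) by (simp add: borel_compact)
  then have "(indicator B :: 'a \<Rightarrow> real) \<in> borel_measurable lebesgue" by simp
  moreover have "bounded (range (indicator B :: 'a \<Rightarrow> real))"
    by (rule boundedI[of _ 1]) (auto simp: indicator_def)
  ultimately show ?thesis using assms by (auto simp: Linf_c_def)
qed

text \<open>The outer function must be Borel, since Lebesgue measurability is not stable under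
  composition. Cutting \<open>f\<close> off to the closed set \<open>K \<times> UNIV\<close> makes
  it Borel, and the same cut-off makes \<open>u\<close> measurable.\<close>

lemma measurable_superposition:
  fixes f :: "'a::euclidean_space \<Rightarrow> real \<Rightarrow> real"
  assumes f: "continuous_on (\<Omega> \<times> UNIV) (\<lambda>(x, t). f x t)" and u: "u \<in> L1_loc \<Omega>"
    and K: "compact K" "K \<subseteq> \<Omega>"
  shows "(\<lambda>x. indicator K x * f x (u x)) \<in> borel_measurable lebesgue"
proof -
  define v where "v x = indicator K x * u x" for x
  have v: "v \<in> borel_measurable lebesgue"
    using u K by (auto simp: L1_loc_def set_integrable_def v_def[abs_def] dest: borel_measurable_integrable)
  have "closed (K \<times> (UNIV::real set))" using K(1) by (simp add: closed_Times compact_imp_closed)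
  then have g: "(\<lambda>q. indicator (K \<times> UNIV) q *\<^sub>R (case q of (x, t) \<Rightarrow> f x t)) \<in> borel_measurable borel"
    using K(2) by (intro borel_measurable_continuous_on_indicator continuous_on_subset[OF f]) auto
  have "(\<lambda>x. (x, v x)) \<in> lebesgue \<rightarrow>\<^sub>M borel"
    using v measurable_completion[of "\<lambda>x. x" lborel borel]
    unfolding borel_prod[symmetric] by (intro measurable_Pair) auto
  from measurable_compose[OF this g]
  have "(\<lambda>x. indicator (K \<times> UNIV) (x, v x) *\<^sub>R f x (v x)) \<in> borel_measurable lebesgue"
    by simp
  also have "(\<lambda>x. indicator (K \<times> UNIV) (x, v x) *\<^sub>R f x (v x)) = (\<lambda>x. indicator K x * f x (u x))"
    by (auto simp: v_def fun_eq_iff indicator_def)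
  finally show ?thesis .
qed

context
  fixes \<Omega> :: "'a::euclidean_space set" and G :: "'a \<Rightarrow> 'a \<Rightarrow> real" and s :: real
  assumes n: "DIM('a) \<ge> 2" and s: "0 < s" "s < 1"
    and \<Omega>: "open \<Omega>" "bounded \<Omega>" "frontier \<Omega> \<noteq> {}"
    and G: "green_kernel s \<Omega> G"
    and trace: "\<And>x \<sigma>. x \<in> \<Omega> \<Longrightarrow> \<sigma> \<in> frontier \<Omega> \<Longrightarrow> \<exists>l. has_Ds s \<Omega> (G x) \<sigma> l"
begin

lemma exponent_neg: "2 * s - real DIM('a) < 0"
  using n s by linarith

lemma fundamental_solution_nonneg: "0 \<le> fundamental_solution s (x::'a)"
  using riesz_const_pos[OF n s] by (simp add: fundamental_solution_eq)

lemma fundamental_solution_mono: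
  fixes x y :: 'a
  assumes "0 < norm x" "norm x \<le> norm y"
  shows "fundamental_solution s y \<le> fundamental_solution s x"
  unfolding fundamental_solution_eq
  using assms riesz_const_pos[OF n s] exponent_neg by (intro mult_left_mono powr_mono2') auto

lemma continuous_on_fundamental_solution:
  "continuous_on (- {x}) (\<lambda>y. fundamental_solution s (x - (y::'a)))"
  unfolding fundamental_solution_eq by (intro continuous_intros) auto

text \<open>
  The trace hypothesis forces the regular part to agree with the fundamental solution also at
  boundary points that are not in the closure of the exterior.
\<close>

lemma green_kernel_zero_outside:
  fixes H :: "'a \<Rightarrow> real"
  assumes x: "x \<in> \<Omega>" and y: "y \<notin> \<Omega>"
    and H: "continuous_on UNIV H" "\<And>y. G x y = fundamental_solution s (x - y) - H y"
      "\<And>y. y \<in> - closure \<Omega> \<Longrightarrow> H y = fundamental_solution s (x - y)"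
  shows "H y = fundamental_solution s (x - y)"
proof (cases "y \<in> closure \<Omega>")
  case True
  then have fr: "y \<in> frontier \<Omega>" using y \<Omega>(1) by (simp add: frontier_def interior_open)
  from trace[OF x this] obtain l where
    l: "((\<lambda>w. G x w / infdist w (frontier \<Omega>) powr s) \<longlongrightarrow> l) (at y within \<Omega>)"
    by (auto simp: has_Ds_def)
  have "((\<lambda>w. infdist w (frontier \<Omega>)) \<longlongrightarrow> infdist y (frontier \<Omega>)) (at y within \<Omega>)"
    by (intro tendsto_infdist tendsto_ident_at)
  then have "((\<lambda>w. infdist w (frontier \<Omega>) powr s) \<longlongrightarrow> 0 powr s) (at y within \<Omega>)"
    using fr s by (intro tendsto_powr') (auto intro!: tendsto_intros simp: infdist_nonneg)
  \<comment> \<open>Multiplying the quotient back by the vanishing power of the distance shows that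
    \<open>G x\<close> tends to 0; continuity identifies the limit with the value at
    \<open>y\<close>.\<close>
  from tendsto_mult[OF l this]
  have "((\<lambda>w. G x w / infdist w (frontier \<Omega>) powr s * infdist w (frontier \<Omega>) powr s) \<longlongrightarrow> 0) (at y within \<Omega>)"
    by simp
  then have "((\<lambda>w. G x w) \<longlongrightarrow> 0) (at y within \<Omega>)"
  proof (rule Lim_transform_eventually)
    show "\<forall>\<^sub>F w in at y within \<Omega>.
        G x w / infdist w (frontier \<Omega>) powr s * infdist w (frontier \<Omega>) powr s = G x w"
      unfolding eventually_at_filter
    proof (intro always_eventually allI impI)
      fix w assume "w \<in> \<Omega>"
      then have "0 < infdist w (frontier \<Omega>)" by (rule infdist_frontier_pos[OF \<Omega>(1,3)])
      then show "G x w / infdist w (frontier \<Omega>) powr s * infdist w (frontier \<Omega>) powr s = G x w"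
        by simp
    qed
  qed
  moreover have "((\<lambda>w. G x w) \<longlongrightarrow> fundamental_solution s (x - y) - H y) (at y within \<Omega>)"
  proof -
    have "isCont (\<lambda>w. fundamental_solution s (x - w)) y"
    proof -
      have "open (- {x})" by (simp add: open_Compl)
      from continuous_on_eq_continuous_at[OF this] continuous_on_fundamental_solution[of x]
      show ?thesis using x y by blast
    qed
    moreover have "isCont H y" using H(1) by (simp add: continuous_on_eq_continuous_at)
    ultimately have "isCont (\<lambda>w. fundamental_solution s (x - w) - H w) y" by (intro continuous_intros)
    then have "isCont (G x) y" by (simp add: H(2)[abs_def])
    then have "((\<lambda>w. G x w) \<longlongrightarrow> G x y) (at y)" by (simp add: isCont_def)
    then show ?thesis unfolding H(2)[symmetric] by (rule tendsto_within_subset) simp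
  qed
  moreover have "at y within \<Omega> \<noteq> bot"
    using True y by (simp add: trivial_limit_within closure_def)
  ultimately have "fundamental_solution s (x - y) - H y = 0" using tendsto_unique by blast
  then show ?thesis by simp
qed (use H in auto)

text \<open>Each inequality compares the regular part: with 0, with a constant, and with the
  fundamental solution, where the constant bound controls the neighbourhood of the pole. The vector
  \<open>w\<close> only stands for its norm, a radius around \<open>x\<close> within the distance to
  the boundary. The diagonal is excluded because \<open>0 powr c = 0\<close> makes
  \<open>G x x\<close> equal to minus the regular part.\<close>

lemma green_kernel_bounds:
  fixes x y w :: 'a
  assumes x: "x \<in> \<Omega>" and xy: "y \<noteq> x"
  shows green_kernel_nonneg: "0 \<le> G x y"
    and green_kernel_le: "G x y \<le> fundamental_solution s (x - y)"
    and green_kernel_ge: "0 < norm w \<Longrightarrow> norm w \<le> infdist x (frontier \<Omega>) \<Longrightarrow>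
      fundamental_solution s (x - y) - fundamental_solution s w \<le> G x y"
    and green_kernel_continuous: "continuous_on (- {x}) (G x)"
proof -
  from G obtain K where "green_regular_part s \<Omega> K"
    and GK: "\<And>x y. x \<in> \<Omega> \<Longrightarrow> G x y = fundamental_solution s (x - y) - K x y"
    by (auto simp: green_kernel_def)
  define H where "H = K x"
  have H: "continuous_on UNIV H" "\<And>y. y \<in> \<Omega> \<Longrightarrow> has_frac_laplacian s H y 0"
    "\<And>y. y \<in> - closure \<Omega> \<Longrightarrow> H y = fundamental_solution s (x - y)"
    using \<open>green_regular_part s \<Omega> K\<close> x by (auto simp: H_def green_regular_part_def)
  have GH: "G x y = fundamental_solution s (x - y) - H y" for y
    using GK[OF x] by (simp add: H_def)
  have out: "H y = fundamental_solution s (x - y)" if "y \<notin> \<Omega>" for y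
    by (rule green_kernel_zero_outside[OF x that H(1) GH H(3)])
  note cmp = frac_comparison[OF s \<Omega>(2,1)]
  have "- H y \<le> 0" for y
    by (rule cmp[where U="{}" and N="{}" and h="\<lambda>y. - H y" and \<phi>="\<lambda>_. 0"])
      (use H out fundamental_solution_nonneg in
        \<open>auto intro!: has_frac_laplacian_minus has_frac_laplacian_const continuous_intros\<close>)
  then show "G x y \<le> fundamental_solution s (x - y)" by (simp add: GH)
  have upper: "H y \<le> fundamental_solution s w"
    if w: "0 < norm w" "norm w \<le> infdist x (frontier \<Omega>)" for w y :: 'a
  proof (rule cmp[where U="{}" and N="{}" and h=H and \<phi>="\<lambda>_. fundamental_solution s w"])
    show "H y \<le> fundamental_solution s w" if "y \<notin> \<Omega>" for y
      unfolding out[OF that] using w infdist_frontier_le[OF x that]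
      by (intro fundamental_solution_mono) auto
  qed (use H in \<open>auto intro!: has_frac_laplacian_const\<close>)
  then show "0 < norm w \<Longrightarrow> norm w \<le> infdist x (frontier \<Omega>) \<Longrightarrow>
      fundamental_solution s (x - y) - fundamental_solution s w \<le> G x y"
    by (simp add: GH)
  define d where "d = infdist x (frontier \<Omega>)"
  have d: "0 < d" unfolding d_def by (rule infdist_frontier_pos[OF \<Omega>(1,3) x])
  obtain b :: 'a where b: "norm b = 1" using norm_Basis nonempty_Basis by blast
  have "H y \<le> fundamental_solution s (x - y)"
  proof (rule cmp[where U="ball x d" and N="{x}" and h=H and \<phi>="\<lambda>y. fundamental_solution s (x - y)"])
    show "AE y in lebesgue. y \<notin> {x}"
      using AE_completion[OF AE_lborel_singleton[of x]] by simp
    show "has_frac_laplacian s (\<lambda>y. fundamental_solution s (x - y)) y 0" if "y \<in> \<Omega> - {x}" for y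
      using that by (intro has_frac_laplacian_fundamental_solution[OF n s]) auto
    show "H y \<le> fundamental_solution s (x - y)" if "y \<in> ball x d - {x}" for y
    proof -
      \<comment> \<open>Within distance \<open>d\<close> of the pole, the fundamental solution lies
        above its value at radius \<open>d\<close>, which already bounds \<open>H\<close>.\<close>
      have "H y \<le> fundamental_solution s (d *\<^sub>R b)"
        using d b by (intro upper) (auto simp: d_def)
      also have "\<dots> \<le> fundamental_solution s (x - y)"
        using that d b by (intro fundamental_solution_mono) (auto simp: dist_norm)
      finally show ?thesis .
    qed
  qed (use H out d xy continuous_on_fundamental_solution in auto)
  then show "0 \<le> G x y" by (simp add: GH)
  have "G x = (\<lambda>y. fundamental_solution s (x - y) - H y)" using GH by auto
  then show "continuous_on (- {x}) (G x)"
    using continuous_on_fundamental_solution[of x] continuous_on_subset[OF H(1)]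
    by (auto intro!: continuous_on_diff)
qed

section \<open>Green's potential and large solutions\<close>

lemma green_potential_nonneg:
  assumes x: "x \<in> \<Omega>" and \<psi>: "\<And>y. 0 \<le> \<psi> y"
  shows "0 \<le> green_potential \<Omega> G \<psi> x"
proof -
  have "AE y in lebesgue. y \<noteq> x" using AE_completion[OF AE_lborel_singleton[of x]] .
  then have "AE y in lebesgue. 0 \<le> indicator \<Omega> y * (G x y * \<psi> y)"
    by eventually_elim (use green_kernel_nonneg[OF x] \<psi> in \<open>simp add: indicator_def\<close>)
  then have "0 \<le> (\<integral>y. indicator \<Omega> y * (G x y * \<psi> y) \<partial>lebesgue)" by (rule integral_nonneg_AE)
  then show ?thesis using x by (simp add: green_potential_def set_lebesgue_integral_def)
qed

lemma green_potential_indicator: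
  assumes "x \<in> \<Omega>" "B \<subseteq> \<Omega>"
  shows "green_potential \<Omega> G (indicator B) x = (\<integral>y. indicator B y * G x y \<partial>lebesgue)"
  using assms unfolding green_potential_def set_lebesgue_integral_def
  by (auto intro!: Bochner_Integration.integral_cong split: split_indicator)

lemma green_potential_indicator_le:
  fixes x w :: 'a
  assumes x: "x \<in> \<Omega>" and B: "compact B" "B \<subseteq> \<Omega>"
    and w: "0 < norm w" "\<And>y. y \<in> B \<Longrightarrow> norm w \<le> norm (x - y)"
  shows "green_potential \<Omega> G (indicator B) x \<le> fundamental_solution s w * measure lebesgue B"
proof -
  have fin: "integrable lebesgue (\<lambda>y. fundamental_solution s w * indicator B y)"
    using B(1) emeasure_bounded_finite[of B] compact_imp_bounded[of B]
    by (intro Bochner_Integration.integrable_mult_right integrable_real_indicator)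
      (auto simp: borel_compact)
  have "(\<integral>y. indicator B y * G x y \<partial>lebesgue) \<le> (\<integral>y. fundamental_solution s w * indicator B y \<partial>lebesgue)"
  proof (rule integral_mono'[OF fin])
    fix y
    show "0 \<le> fundamental_solution s w * indicator B y" by (simp add: fundamental_solution_nonneg)
    show "indicator B y * G x y \<le> fundamental_solution s w * indicator B y"
    proof (cases "y \<in> B")
      case True
      then have "0 < norm (x - y)" using w by force
      then have "G x y \<le> fundamental_solution s (x - y)" using green_kernel_le[OF x] by auto
      also have "\<dots> \<le> fundamental_solution s w" using True w by (intro fundamental_solution_mono) auto
      finally show ?thesis using True by simp
    qed simp
  qed
  then show ?thesis by (simp add: green_potential_indicator[OF x B(2)])
qed

text \<open>The bound has content when \<open>norm v < norm w\<close>, that is, when all of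
  \<open>B\<close> is closer to \<open>x\<close> than the boundary is.\<close>

lemma green_potential_indicator_ge:
  fixes x v w :: 'a
  assumes x: "x \<in> \<Omega>" and B: "compact B" "B \<subseteq> \<Omega>" "x \<notin> B"
    and v: "\<And>y. y \<in> B \<Longrightarrow> norm (x - y) \<le> norm v"
    and w: "0 < norm w" "norm w \<le> infdist x (frontier \<Omega>)"
  shows "(fundamental_solution s v - fundamental_solution s w) * measure lebesgue B
    \<le> green_potential \<Omega> G (indicator B) x"
proof -
  have fin: "integrable lebesgue (\<lambda>y. (fundamental_solution s v - fundamental_solution s w) * indicator B y)"
    using B(1) emeasure_bounded_finite[of B] compact_imp_bounded[of B]
    by (intro Bochner_Integration.integrable_mult_right integrable_real_indicator)
      (auto simp: borel_compact)
  \<comment> \<open>Continuity of \<open>G x\<close> was proved under the assumption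
    \<open>y \<noteq> x\<close> shared by its lemma, so some point other than \<open>x\<close> has
    to be supplied.\<close>
  obtain y0 where y0: "y0 \<noteq> x" using B(3) perfect_choose_dist[of 1 x] by auto
  have "continuous_on B (G x)"
    using B(3) by (intro continuous_on_subset[OF green_kernel_continuous[OF x y0]]) auto
  then have int: "integrable lborel (\<lambda>y. indicator B y *\<^sub>R G x y)"
    using B(1) by (intro borel_integrable_compact)
  have G_int: "integrable lebesgue (\<lambda>y. indicator B y * G x y)"
    using int borel_measurable_integrable[OF int] by (simp add: integrable_completion)
  have "(\<integral>y. (fundamental_solution s v - fundamental_solution s w) * indicator B y \<partial>lebesgue)
      \<le> (\<integral>y. indicator B y * G x y \<partial>lebesgue)"
  proof (rule integral_mono[OF fin G_int])
    fix y
    show "(fundamental_solution s v - fundamental_solution s w) * indicator B y \<le> indicator B y * G x y"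
    proof (cases "y \<in> B")
      case True
      then have "y \<noteq> x" using B(3) by auto
      then have "fundamental_solution s v \<le> fundamental_solution s (x - y)"
        using v[OF True] by (intro fundamental_solution_mono) auto
      then show ?thesis using green_kernel_ge[OF x \<open>y \<noteq> x\<close> w] True by simp
    qed simp
  qed
  then show ?thesis by (simp add: green_potential_indicator[OF x B(2)])
qed

text \<open>
  The Green potential of the indicator of a small ball close to, but away from, \<open>z\<close> is bounded
  below near \<open>z\<close>.
\<close>

lemma integrable_of_integrable_potentials:
  fixes F :: "'a \<Rightarrow> real"
  assumes K: "compact K" "K \<subseteq> \<Omega>"
    and F: "(\<lambda>x. indicator K x * F x) \<in> borel_measurable lebesgue"
    and int: "\<And>\<psi>. \<psi> \<in> Linf_c \<Omega> \<Longrightarrow> set_integrable lebesgue \<Omega> (\<lambda>x. F x * green_potential \<Omega> G \<psi> x)"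
  shows "set_integrable lebesgue K F"
proof -
  \<comment> \<open>One eighth leaves room: the test ball lies within \<open>4 * r z\<close> of
    \<open>z\<close>; a point \<open>x\<close> with \<open>norm (z - x) < r z\<close> sees it at
    distances between \<open>r z\<close> and \<open>5 * r z\<close>, yet is at least
    \<open>7 * r z\<close> from the boundary. The radii 5 and 6 of \<open>v\<close> and
    \<open>w\<close> fit in between.\<close>
  define r where "r z = infdist z (frontier \<Omega>) / 8" for z
  have r: "0 < r z" if "z \<in> K" for z
    using infdist_frontier_pos[OF \<Omega>(1,3), of z] that K(2) by (auto simp: r_def)
  obtain b :: 'a where b: "norm b = 1" using norm_Basis nonempty_Basis by blast
  have K_sets: "K \<in> sets lebesgue" using K(1) by (simp add: borel_compact)
  have local: "set_integrable lebesgue (K \<inter> ball z (r z)) F" if z: "z \<in> K" for z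
  proof -
    define B where "B = cball (z + (3 * r z) *\<^sub>R b) (r z)"
    have zr: "0 < r z" by (rule r[OF z])
    have "B \<subseteq> cball z (4 * r z)"
    proof
      fix y assume "y \<in> B"
      then show "y \<in> cball z (4 * r z)"
        using dist_triangle[of z y "z + (3 * r z) *\<^sub>R b"] b zr by (simp add: B_def dist_norm)
    qed
    also have "\<dots> \<subseteq> \<Omega>"
      using z K(2) zr by (intro cball_subset_domain) (auto simp: r_def)
    finally have B: "compact B" "B \<subseteq> \<Omega>" by (simp_all add: B_def)
    define v where "v = (5 * r z) *\<^sub>R b"
    define w where "w = (6 * r z) *\<^sub>R b"
    have nv: "norm v = 5 * r z" "norm w = 6 * r z" using b zr by (simp_all add: v_def w_def)
    define c where "c = (fundamental_solution s v - fundamental_solution s w) * measure lebesgue B"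
    have "fundamental_solution s w < fundamental_solution s v"
      unfolding fundamental_solution_eq nv using riesz_const_pos[OF n s] exponent_neg zr
      by (intro mult_strict_left_mono powr_less_mono2_neg) auto
    moreover have "0 < measure lebesgue B" using zr by (simp add: B_def content_cball_pos)
    ultimately have c: "0 < c" by (simp add: c_def)
    have low: "c \<le> green_potential \<Omega> G (indicator B) x" if x: "x \<in> K \<inter> ball z (r z)" for x
    proof -
      have xz: "norm (z - x) < r z" using x by (simp add: dist_norm)
      have d: "r z < norm (x - y)" "norm (x - y) \<le> 5 * r z" if "y \<in> B" for y
      proof -
        let ?q = "z + (3 * r z) *\<^sub>R b"
        have 1: "norm (?q - y) \<le> r z" using that by (simp add: B_def dist_norm)
        have 2: "norm (?q - z) = 3 * r z" using b zr by simp
        have "norm (?q - z) \<le> norm (?q - y) + norm (y - x) + norm (x - z)"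
          using norm_triangle_ineq[of "?q - y" "y - x"] norm_triangle_ineq[of "?q - x" "x - z"] by simp
        then show "r z < norm (x - y)" using 1 2 xz by (simp add: norm_minus_commute)
        have "norm (x - y) \<le> norm (x - z) + norm (z - ?q) + norm (?q - y)"
          using norm_triangle_ineq[of "x - z" "z - y"] norm_triangle_ineq[of "z - ?q" "?q - y"] by simp
        then show "norm (x - y) \<le> 5 * r z" using 1 2 xz by (simp add: norm_minus_commute)
      qed
      have "infdist z (frontier \<Omega>) \<le> infdist x (frontier \<Omega>) + dist z x"
        by (rule infdist_triangle)
      then have "norm w \<le> infdist x (frontier \<Omega>)"
        using xz nv zr by (simp add: r_def dist_norm)
      then show ?thesis
        unfolding c_def using x K(2) B d zr nv
        by (intro green_potential_indicator_ge) force+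
    qed
    have dom: "integrable lebesgue (\<lambda>x. 1 / c * (indicator \<Omega> x * (F x * green_potential \<Omega> G (indicator B) x)))"
      using int[OF indicator_in_Linf_c[OF B]] by (intro Bochner_Integration.integrable_mult_right)
        (simp add: set_integrable_def)
    have "(\<lambda>x. indicator (ball z (r z)) x * (indicator K x * F x)) \<in> borel_measurable lebesgue"
      by (rule borel_measurable_times[OF borel_measurable_indicator F]) auto
    then have meas: "(\<lambda>x. indicator (K \<inter> ball z (r z)) x *\<^sub>R F x) \<in> borel_measurable lebesgue"
      by (simp add: indicator_inter_arith ac_simps)
    show ?thesis
      unfolding set_integrable_def
    proof (rule Bochner_Integration.integrable_bound[OF dom meas AE_I2])
      fix x
      show "norm (indicator (K \<inter> ball z (r z)) x *\<^sub>R F x)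
        \<le> norm (1 / c * (indicator \<Omega> x * (F x * green_potential \<Omega> G (indicator B) x)))"
      proof (cases "x \<in> K \<inter> ball z (r z)")
        case True
        have "c * \<bar>F x\<bar> \<le> green_potential \<Omega> G (indicator B) x * \<bar>F x\<bar>"
          by (intro mult_right_mono low[OF True]) simp
        moreover have "0 \<le> green_potential \<Omega> G (indicator B) x" using low[OF True] c by simp
        ultimately show ?thesis using True K(2) c by (auto simp: abs_mult field_simps)
      qed simp
    qed
  qed
  have "K \<subseteq> (\<Union>z\<in>K. ball z (r z))" using r by force
  then obtain T where T: "T \<subseteq> K" "finite T" "K \<subseteq> (\<Union>z\<in>T. ball z (r z))"
    using compactE_image[OF K(1), of K "\<lambda>z. ball z (r z)"] by auto
  have "set_integrable lebesgue (\<Union>z\<in>T. K \<inter> ball z (r z)) F"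
    using T(1,2) local K_sets by (intro set_integrable_UN) auto
  moreover have "(\<Union>z\<in>T. K \<inter> ball z (r z)) = K" using T(3) by auto
  ultimately show ?thesis by simp
qed

lemma no_large_solution:
  fixes f :: "'a \<Rightarrow> real \<Rightarrow> real"
  assumes f: "continuous_on (\<Omega> \<times> UNIV) (\<lambda>(x, t). f x t)" "\<And>x t. x \<in> \<Omega> \<Longrightarrow> 0 < t \<Longrightarrow> 0 \<le> f x t"
    and large: "large_solution s \<Omega> G f u"
  shows False
proof -
  let ?d = "\<lambda>x. infdist x (frontier \<Omega>)"
  define F where "F x = f x (u x)" for x
  have u: "u \<in> L1_loc \<Omega>"
    and int: "\<And>\<psi>. \<psi> \<in> Linf_c \<Omega> \<Longrightarrow> set_integrable lebesgue \<Omega> (\<lambda>x. F x * green_potential \<Omega> G \<psi> x)"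
    and eq: "\<And>\<psi>. \<psi> \<in> Linf_c \<Omega> \<Longrightarrow> (LINT x : \<Omega> | lebesgue. u x * \<psi> x) =
          - (LINT x : \<Omega> | lebesgue. F x * green_potential \<Omega> G \<psi> x)"
    and blow: "\<And>M. \<exists>\<eta>>0. \<forall>x\<in>\<Omega>. ?d x < \<eta> \<longrightarrow> M < u x"
    using large by (auto simp: large_solution_def weak_dual_solution_def blows_up_at_boundary_def F_def)
  obtain \<eta> where \<eta>: "0 < \<eta>" "\<And>x. x \<in> \<Omega> \<Longrightarrow> ?d x < \<eta> \<Longrightarrow> 0 < u x" using blow[of 0] by auto
  \<comment> \<open>Only on \<open>K\<close> is the sign of \<open>u\<close>, and hence of
    \<open>F\<close>, unknown.\<close>
  define K where "K = closure \<Omega> \<inter> {x. \<eta> \<le> ?d x}"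
  have "closed {x. \<eta> \<le> ?d x}" by (intro closed_Collect_le continuous_intros)
  then have K: "compact K" using \<Omega>(2) by (simp add: K_def compact_Int_closed)
  have K\<Omega>: "K \<subseteq> \<Omega>"
  proof
    fix x assume x: "x \<in> K"
    then have "x \<notin> frontier \<Omega>" using \<eta>(1) by (auto simp: K_def)
    then show "x \<in> \<Omega>" using x \<Omega>(1) by (auto simp: K_def frontier_def interior_open)
  qed
  have F_pos: "0 \<le> F x" if "x \<in> \<Omega>" "x \<notin> K" for x
    using that closure_subset[of \<Omega>] f(2) \<eta>(2)[of x] by (force simp: F_def K_def)
  have F_int: "set_integrable lebesgue K F"
    using measurable_superposition[OF f(1) u K K\<Omega>] int
    by (intro integrable_of_integrable_potentials[OF K K\<Omega>]) (auto simp: F_def)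
  obtain b :: 'a where b: "norm b = 1" using norm_Basis nonempty_Basis by blast
  define w where "w = (\<eta> / 2) *\<^sub>R b"
  have w: "norm w = \<eta> / 2" "0 < norm w" using b \<eta>(1) by (simp_all add: w_def)
  define I where "I = (\<integral>x. indicator K x * \<bar>F x\<bar> \<partial>lebesgue)"
  \<comment> \<open>\<open>C\<close> is fixed before the test ball is chosen, so blow-up can be
    invoked with the level \<open>C + 1\<close>.\<close>
  define C where "C = fundamental_solution s w * I"
  obtain \<eta>' where \<eta>': "0 < \<eta>'" "\<And>x. x \<in> \<Omega> \<Longrightarrow> ?d x < \<eta>' \<Longrightarrow> C + 1 < u x" using blow[of "C + 1"] by auto
  \<comment> \<open>The first entry forces \<open>u > C + 1\<close> on the ball; the second keeps
    the ball at distance at least \<open>\<eta> / 2 = norm w\<close> from \<open>K\<close>.\<close>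
  define \<eta>'' where "\<eta>'' = min \<eta>' (\<eta> / 2)"
  have "0 < \<eta>''" using \<eta> \<eta>' by (simp add: \<eta>''_def)
  obtain \<theta> where \<theta>: "\<theta> \<in> frontier \<Omega>" using \<Omega>(3) by auto
  then have "\<theta> \<in> closure \<Omega>" by (simp add: frontier_def)
  then obtain y0 where y0: "y0 \<in> \<Omega>" "dist y0 \<theta> < \<eta>'' / 2"
    using \<open>0 < \<eta>''\<close> by (meson closure_approachable half_gt_zero)
  have dy0: "0 < ?d y0" "?d y0 < \<eta>'' / 2"
    using infdist_frontier_pos[OF \<Omega>(1,3) y0(1)] infdist_le[OF \<theta>, of y0] y0(2) by auto
  \<comment> \<open>Half the distance keeps the ball inside \<open>\<Omega>\<close>, and its points
    have boundary distance at most 3/2 of that of \<open>y0\<close>, still below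
    \<open>\<eta>''\<close>.\<close>
  define B where "B = cball y0 (?d y0 / 2)"
  have B: "compact B" "B \<subseteq> \<Omega>" using cball_subset_domain[OF y0(1)] dy0 by (auto simp: B_def)
  have dB: "?d y < \<eta>''" if "y \<in> B" for y
    using that infdist_triangle[of y "frontier \<Omega>" y0] dy0 by (simp add: B_def dist_commute)
  define m where "m = measure lebesgue B"
  have m: "0 < m" using dy0 by (simp add: m_def B_def content_cball_pos)
  define P where "P = green_potential \<Omega> G (indicator B)"
  have \<psi>: "indicator B \<in> Linf_c \<Omega>" by (rule indicator_in_Linf_c[OF B])
  have P0: "0 \<le> P x" if "x \<in> \<Omega>" for x
    unfolding P_def by (rule green_potential_nonneg[OF that]) simp
  have PK: "P x \<le> fundamental_solution s w * m" if x: "x \<in> K" for x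
    unfolding P_def m_def
  proof (rule green_potential_indicator_le[OF _ B w(2)])
    show "x \<in> \<Omega>" using x K\<Omega> by auto
    fix y assume "y \<in> B"
    then have "?d y < \<eta> / 2" using dB by (auto simp: \<eta>''_def)
    moreover have "\<eta> \<le> ?d x" using x by (simp add: K_def)
    ultimately show "norm w \<le> norm (x - y)"
      using infdist_triangle[of x "frontier \<Omega>" y] w(1) by (simp add: dist_norm)
  qed
  have u_int: "integrable lebesgue (\<lambda>x. indicator B x * u x)"
    using u B by (simp add: L1_loc_def set_integrable_def)
  have c_int: "integrable lebesgue (\<lambda>x. (C + 1) * indicator B x)"
    using B(1) emeasure_bounded_finite[of B] compact_imp_bounded[of B]
    by (intro Bochner_Integration.integrable_mult_right integrable_real_indicator)
      (auto simp: borel_compact)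
  have "(C + 1) * m = (\<integral>x. (C + 1) * indicator B x \<partial>lebesgue)" by (simp add: m_def)
  also have "\<dots> \<le> (\<integral>x. indicator B x * u x \<partial>lebesgue)"
  proof (rule integral_mono[OF c_int u_int])
    show "(C + 1) * indicator B x \<le> indicator B x * u x" for x
      using \<eta>'(2)[of x] dB[of x] B(2) by (force simp: indicator_def \<eta>''_def)
  qed
  also have "\<dots> = (LINT x : \<Omega> | lebesgue. u x * indicator B x)"
    unfolding set_lebesgue_integral_def using B(2)
    by (auto intro!: Bochner_Integration.integral_cong split: split_indicator)
  also have "\<dots> = - (LINT x : \<Omega> | lebesgue. F x * P x)"
    unfolding P_def by (rule eq[OF \<psi>])
  also have "\<dots> = (\<integral>x. - (indicator \<Omega> x * (F x * P x)) \<partial>lebesgue)"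
    by (simp add: set_lebesgue_integral_def)
  also have "\<dots> \<le> (\<integral>x. fundamental_solution s w * m * (indicator K x * \<bar>F x\<bar>) \<partial>lebesgue)"
  proof (rule integral_mono)
    show "integrable lebesgue (\<lambda>x. - (indicator \<Omega> x * (F x * P x)))"
      using int[OF \<psi>] by (simp add: set_integrable_def P_def)
    show "integrable lebesgue (\<lambda>x. fundamental_solution s w * m * (indicator K x * \<bar>F x\<bar>))"
      using set_integrable_abs[OF F_int]
      by (intro Bochner_Integration.integrable_mult_right) (simp add: set_integrable_def)
    fix x
    show "- (indicator \<Omega> x * (F x * P x)) \<le> fundamental_solution s w * m * (indicator K x * \<bar>F x\<bar>)"
    proof (cases "x \<in> K")
      case True
      then have x: "x \<in> \<Omega>" using K\<Omega> by auto
      have "- (F x * P x) \<le> \<bar>F x\<bar> * P x"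
        using mult_right_mono[of "- F x" "\<bar>F x\<bar>" "P x"] P0[OF x] by simp
      also have "\<dots> \<le> \<bar>F x\<bar> * (fundamental_solution s w * m)"
        using PK[OF True] by (intro mult_left_mono) auto
      finally show ?thesis using True x by (simp add: ac_simps)
    next
      case False
      then show ?thesis using F_pos[of x] P0[of x] by (simp add: indicator_def)
    qed
  qed
  also have "\<dots> = C * m" by (simp add: C_def I_def)
  finally show False using m by (simp add: distrib_right)
qed

end

theorem theorem4p9:
  fixes \<Omega> :: "'a::euclidean_space set"
    and G :: "'a \<Rightarrow> 'a \<Rightarrow> real"
    and f :: "'a \<Rightarrow> real \<Rightarrow> real"
    and s a\<^sub>1 a\<^sub>2 p :: real
  assumes "DIM('a) \<ge> 2"
    and "0 < s" and "s < 1"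
    and "open \<Omega>" and "connected \<Omega>" and "\<Omega> \<noteq> {}" and "bounded \<Omega>"
    and "green_kernel s \<Omega> G"
    and "continuous_on (\<Omega> \<times> UNIV) (\<lambda>(x, t). f x t)"
    and "\<And>x. x \<in> \<Omega> \<Longrightarrow> f x 0 = 0"
    and "\<And>x t. x \<in> \<Omega> \<Longrightarrow> t > 0 \<Longrightarrow> f x t \<ge> 0"
    and "a\<^sub>1 \<ge> 0" and "a\<^sub>2 \<ge> 0" and "0 \<le> p" and "p < (1 + s) / (1 - s)"
    and "\<And>x t. x \<in> \<Omega> \<Longrightarrow> t > 0 \<Longrightarrow> f x t \<le> a\<^sub>1 + a\<^sub>2 * t powr p"
  shows "\<not> (\<exists>u. large_solution s \<Omega> G f u)"
proof
  assume "\<exists>u. large_solution s \<Omega> G f u"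
  then obtain u where u: "large_solution s \<Omega> G f u" ..
  have "\<Omega> \<noteq> UNIV" using assms(7) not_bounded_UNIV by blast
  with assms(6) have fr: "frontier \<Omega> \<noteq> {}" by (rule frontier_not_empty)
  then obtain \<theta> where "\<theta> \<in> frontier \<Omega>" by auto
  \<comment> \<open>\<open>has_E\<close> at a single boundary point already contains the traces of
    \<open>G x\<close> at all boundary points, for all \<open>x\<close>.\<close>
  then have "has_E s \<Omega> G u \<theta> 0"
    using u by (auto simp: large_solution_def weak_dual_solution_def)
  then have "\<exists>l. has_Ds s \<Omega> (G x) \<sigma> l" if "x \<in> \<Omega>" "\<sigma> \<in> frontier \<Omega>" for x \<sigma>
    using that by (auto simp: has_E_def)
  from no_large_solution[OF assms(1-4,7) fr assms(8) this assms(9,11) u]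
  show False .
qed

end
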